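(* Let $\Phi$ be the $2$-dimensional morphism on the alphabet $\{0,1,\dots,15\}$, $\mathcal{P}_{\mathcal{Z}}$ the topological partition of $\mathbb{T}^2=\mathbb{R}^2/\mathbb{Z}^2$ into the $16$ polygonal atoms $P_0,\dots,P_{15}$, and $R_{\mathcal{Z}}$ the $\mathbb{Z}^2$-action on $\mathbb{T}^2$ given in the context. The subshift $\mathcal{X}_{\mathcal{P}_{\mathcal{Z}},R_{\mathcal{Z}}}\subset\{0,\dots,15\}^{\mathbb{Z}^2}$ is self-similar, satisfying $$\mathcal{X}_{\mathcal{P}_{\mathcal{Z}},R_{\mathcal{Z}}}=\overline{\Phi(\mathcal{X}_{\mathcal{P}_{\mathcal{Z}},R_{\mathcal{Z}}})}^{\sigma}.$$
   Context: **Words and subshifts.** Let $\mathcal{A}$ be a finite alphabet. A $2$-dimensional word of shape $(n_1,n_2)\in\mathbb{N}^2$ is a map $u:\{0,\dots,n_1-1\}\times\{0,\dots,n_2-1\}\to\mathcal{A}$. It is written as a matrix in Cartesian coordinates: the first coordinate increases to the right and the second increases upwards, so the bottom row is $u_{0,0},\dots,u_{n_1-1,0}$. $\mathcal{A}^{*^2}$ is the set of all such words. Concatenation $u\odot^1v$ places $v$ to the right of $u$ (defined when heights agree); $u\odot^2v$ places $v$ above $u$ (defined when widths agree). The shift on $\mathcal{A}^{\mathbb{Z}^2}$ is $(\sigma^{n}(x))_m=x_{m+n}$. A subshift is a closed (product topology) shift-invariant subset of $\mathcal{A}^{\mathbb{Z}^2}$. For $X\subset\mathcal{A}^{\mathbb{Z}^2}$,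 $\overline{X}^{\sigma}=\{\sigma^n(x): x\in X, n\in\mathbb{Z}^2\}$ (closure under the shift, not topological closure). **Morphisms.** A $2$-dimensional morphism $\omega$, given by a rule $\mathcal{A}\to\mathcal{B}^{*^2}$ on letters, satisfies $\omega(u\odot^iv)=\omega(u)\odot^i\omega(v)$ for $i\in\{1,2\}$ on every word where the required concatenations of images are defined. It is applied to a configuration $x\in\mathcal{A}^{\mathbb{Z}^2}$ (when images of adjacent letters have matching dimensions) by replacing every letter by its image, so that the lower left letter of $\omega(x_{(0,0)})$ is at the origin of $\omega(x)$. A morphism $\omega:\mathcal{A}\to\mathcal{A}^{*^2}$ is expansive if for every $a\in\mathcal{A}$ and $K\in\mathbb{N}$ there is $m\in\mathbb{N}$ such that both the width and the height of $\omega^m(a)$ exceed $K$. A subshift $X\subseteq\mathcal{A}^{\mathbb{Z}^2}$ is self-similar if $X=\overline{\omega(X)}^{\sigma}$ for some expansive $2$-dimensional morphism $\omega:\mathcal{A}\to\mathcal{A}^{*^2}$. **The morphism $\Phi$.** $0\mapsto(14)$, $1\mapsto(13)$, $2\mapsto(12\ 10)$, $3\mapsto(11\ 8)$, $4\mapsto(14\ 7)$, $5\mapsto(13\ 7)$, $6\mapsto(12\ 7)$, $7\mapsto\begin{pmatrix}6\\12\end{pmatrix}$, $8\mapsto\begin{pmatrix}3\\14\end{pmatrix}$, $9\mapsto\begin{pmatrix}3\\13\end{pmatrix}$, $10\mapsto\begin{pmatrix}2\\12\end{pmatrix}$, $11\mapsto\begin{pmatrix}6&1\\12&10\end{pmatrix}$,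 $12\mapsto\begin{pmatrix}6&1\\11&8\end{pmatrix}$, $13\mapsto\begin{pmatrix}5&1\\15&9\end{pmatrix}$, $14\mapsto\begin{pmatrix}4&1\\11&8\end{pmatrix}$, $15\mapsto\begin{pmatrix}2&0\\12&7\end{pmatrix}$. **The action.** $\varphi=\frac{1+\sqrt5}{2}$, and $R_{\mathcal{Z}}^{n}(x)=x+\varphi^{-2}n$ on $\mathbb{T}^2$, for $n\in\mathbb{Z}^2$. **The partition.** $\mathcal{P}_{\mathcal{Z}}=\{P_0,\dots,P_{15}\}$, where $P_a$ is the image in $\mathbb{T}^2$ of the open convex polygon in $[0,1]^2$ (interior of the convex hull) with the following vertices. The boundaries are the images mod $\mathbb{Z}^2$ of the segments $(1,\varphi^2)\to(0,\varphi^2)\to(\varphi,0)\to(\varphi,1)$, $(1,1)\to(0,1)\to(1,0)\to(1,1)$ and $(\varphi^{-2},2)\to(1+\varphi^{-2},1)$. - $P_0$: $(\varphi^{-1},\varphi^{-1}),(2\varphi^{-2},\varphi^{-1}),(\varphi^{-1},2\varphi^{-2})$ - $P_1$: $(2\varphi^{-2},\varphi^{-1}),(1,\varphi^{-1}),(1,1),(\varphi^{-1},1),(\varphi^{-1},2\varphi^{-2})$ - $P_2$: $(\varphi^{-3},\varphi^{-1}),(\varphi^{-2},\varphi^{-1}),(0,1)$ - $P_3$: $(0,\varphi^{-1}),(\varphi^{-3},\varphi^{-1}),(0,1)$ - $P_4$: $(\varphi^{-1},\varphi^{-1}),(\varphi^{-1},2\varphi^{-2}),(\varphi^{-2},1)$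 - $P_5$: $(\varphi^{-2},1),(\varphi^{-1},2\varphi^{-2}),(\varphi^{-1},1)$ - $P_6$: $(\varphi^{-2},\varphi^{-1}),(\varphi^{-1},\varphi^{-1}),(\varphi^{-2},1),(0,1)$ - $P_7$: $(\varphi^{-1},0),(1,0),(\varphi^{-1},\varphi^{-2})$ - $P_8$: $(\varphi^{-1},\varphi^{-1}),(1,0),(1,\varphi^{-2}),(2\varphi^{-2},\varphi^{-1})$ - $P_9$: $(2\varphi^{-2},\varphi^{-1}),(1,\varphi^{-2}),(1,\varphi^{-1})$ - $P_{10}$: $(\varphi^{-1},\varphi^{-2}),(1,0),(\varphi^{-1},\varphi^{-1})$ - $P_{11}$: $(\varphi^{-1},0),(\varphi^{-1},\varphi^{-2}),(\varphi^{-2},\varphi^{-1}),(\varphi^{-3},\varphi^{-1})$ - $P_{12}$: $(\varphi^{-2},0),(\varphi^{-1},0),(\varphi^{-3},\varphi^{-1}),(0,\varphi^{-1})$ - $P_{13}$: $(0,0),(\varphi^{-2},0),(0,\varphi^{-2})$ - $P_{14}$: $(\varphi^{-2},0),(0,\varphi^{-1}),(0,\varphi^{-2})$ - $P_{15}$: $(\varphi^{-2},\varphi^{-1}),(\varphi^{-1},\varphi^{-2}),(\varphi^{-1},\varphi^{-1})$ **Symbolic dynamical system.** For a topological partition $\mathcal{P}=\{P_a\}_{a\in\mathcal{A}}$ of the torus (finitely many disjoint open sets whose closures cover) and a $\mathbb{Z}^2$-rotation $R$, a pattern $w\in\mathcal{A}^S$ with $S\subset\mathbb{Z}^2$ finite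 is allowed if $\bigcap_{k\in S}R^{-k}(P_{w_k})\neq\varnothing$. $\mathcal{X}_{\mathcal{P},R}$ is the set of $x\in\mathcal{A}^{\mathbb{Z}^2}$ such that for all $n\in\mathbb{Z}^2$ and finite $S\subset\mathbb{Z}^2$ the restriction of $\sigma^n(x)$ to $S$ is allowed. *)

theory Defs
  imports "HOL-Analysis.Analysis"
begin

section \<open>Words, configurations and subshifts\<close>

text \<open>A word is its shape together with its map, the latter being extensional on the rectangle of
  the shape.  Positions are integers so that words and configurations share the definitions below.\<close>

type_synonym 'a config = "int \<times> int \<Rightarrow> 'a"
type_synonym 'a word2 = "(nat \<times> nat) \<times> 'a config"

abbreviation width :: "'a word2 \<Rightarrow> nat" where "width u \<equiv> fst (fst u)"
abbreviation height :: "'a word2 \<Rightarrow> nat" where "height u \<equiv> snd (fst u)"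
abbreviation letters :: "'a word2 \<Rightarrow> 'a config" where "letters u \<equiv> snd u"

definition rect :: "nat \<times> nat \<Rightarrow> (int \<times> int) set" where
  "rect n = {0..<int (fst n)} \<times> {0..<int (snd n)}"

definition words2 :: "'a set \<Rightarrow> 'a word2 set" where
  "words2 A = {(n, u). u \<in> rect n \<rightarrow>\<^sub>E A}"

definition letter_word :: "'a \<Rightarrow> 'a word2" where
  "letter_word a = ((1, 1), \<lambda>p\<in>rect (1, 1). a)"

text \<open>The concatenations are meaningful for words of equal height, respectively equal width.\<close>

definition hcat :: "'a word2 \<Rightarrow> 'a word2 \<Rightarrow> 'a word2"  (infixr "\<odot>\<^sup>1" 65) where
  "u \<odot>\<^sup>1 v = ((width u + width v, height u),
     restrict (\<lambda>(i, j). if i < int (width u) then letters u (i, j)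
                        else letters v (i - int (width u), j))
       (rect (width u + width v, height u)))"

definition vcat :: "'a word2 \<Rightarrow> 'a word2 \<Rightarrow> 'a word2"  (infixr "\<odot>\<^sup>2" 65) where
  "u \<odot>\<^sup>2 v = ((width u, height u + height v),
     restrict (\<lambda>(i, j). if j < int (height u) then letters u (i, j)
                        else letters v (i, j - int (height u)))
       (rect (width u, height u + height v)))"

definition shift :: "int \<times> int \<Rightarrow> 'a config \<Rightarrow> 'a config" where
  "shift n x = (\<lambda>m. x (m + n))"

definition subshift :: "'a set \<Rightarrow> 'a config set \<Rightarrow> bool" where
  "subshift A X \<longleftrightarrow>
     closedin (product_topology (\<lambda>_. discrete_topology A) UNIV) X \<and>
     (\<forall>n. \<forall>x\<in>X. shift n x \<in> X)"

definition shift_closure :: "'a config set \<Rightarrow> 'a config set" where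
  "shift_closure X = {shift n x | n x. x \<in> X}"


section \<open>Two-dimensional morphisms\<close>

text \<open>A morphism is represented by its rule on letters.  It can be applied to a pattern on a domain
  \<open>D\<close> when the images of adjacent letters fit together.\<close>

definition matching :: "('a \<Rightarrow> 'b word2) \<Rightarrow> (int \<times> int) set \<Rightarrow> 'a config \<Rightarrow> bool" where
  "matching \<omega> D x \<longleftrightarrow>
     (\<forall>i j. (i, j) \<in> D \<and> (i + 1, j) \<in> D \<longrightarrow> height (\<omega> (x (i, j))) = height (\<omega> (x (i + 1, j)))) \<and>
     (\<forall>i j. (i, j) \<in> D \<and> (i, j + 1) \<in> D \<longrightarrow> width (\<omega> (x (i, j))) = width (\<omega> (x (i, j + 1))))"

text \<open>If the column widths (or row heights) of an image are \<open>d i\<close>, then \<open>pos d i\<close> is the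
  coordinate at which the image of column (or row) \<open>i\<close> begins, the one with index 0 beginning at 0;
  \<open>locate d p\<close> is the index of the column (or row) covering coordinate \<open>p\<close>.\<close>

definition pos :: "(int \<Rightarrow> nat) \<Rightarrow> int \<Rightarrow> int" where
  "pos d i = (if 0 \<le> i then (\<Sum>k\<in>{0..<i}. int (d k)) else - (\<Sum>k\<in>{i..<0}. int (d k)))"

definition locate :: "(int \<Rightarrow> nat) \<Rightarrow> int \<Rightarrow> int" where
  "locate d p = (THE i. pos d i \<le> p \<and> p < pos d (i + 1))"

definition col_width :: "('a \<Rightarrow> 'b word2) \<Rightarrow> 'a config \<Rightarrow> int \<Rightarrow> nat" where
  "col_width \<omega> x i = width (\<omega> (x (i, 0)))"

definition row_height :: "('a \<Rightarrow> 'b word2) \<Rightarrow> 'a config \<Rightarrow> int \<Rightarrow> nat" where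
  "row_height \<omega> x j = height (\<omega> (x (0, j)))"

text \<open>The image of a configuration, meaningful when \<open>matching \<omega> UNIV x\<close> and the images of the
  letters are non-empty; every rule that is expansive in the sense below has the latter property.\<close>

definition config_image :: "('a \<Rightarrow> 'b word2) \<Rightarrow> 'a config \<Rightarrow> 'b config" where
  "config_image \<omega> x = (\<lambda>(p, q).
     let i = locate (col_width \<omega> x) p; j = locate (row_height \<omega> x) q
     in letters (\<omega> (x (i, j))) (p - pos (col_width \<omega> x) i, q - pos (row_height \<omega> x) j))"

definition word_defined :: "('a \<Rightarrow> 'b word2) \<Rightarrow> 'a word2 \<Rightarrow> bool" where
  "word_defined \<omega> u \<longleftrightarrow> 0 < width u \<and> 0 < height u \<and> matching \<omega> (rect (fst u)) (letters u)"

definition word_image :: "('a \<Rightarrow> 'b word2) \<Rightarrow> 'a word2 \<Rightarrow> 'b word2" where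
  "word_image \<omega> u =
     (let n = (nat (pos (col_width \<omega> (letters u)) (int (width u))),
               nat (pos (row_height \<omega> (letters u)) (int (height u))))
      in (n, restrict (config_image \<omega> (letters u)) (rect n)))"

definition iterate_defined :: "('a \<Rightarrow> 'a word2) \<Rightarrow> nat \<Rightarrow> 'a \<Rightarrow> bool" where
  "iterate_defined \<omega> m a \<longleftrightarrow> (\<forall>k<m. word_defined \<omega> ((word_image \<omega> ^^ k) (letter_word a)))"

definition expansive :: "'a set \<Rightarrow> ('a \<Rightarrow> 'a word2) \<Rightarrow> bool" where
  "expansive A \<omega> \<longleftrightarrow>
     (\<forall>a\<in>A. \<forall>K. \<exists>m. iterate_defined \<omega> m a \<and>
        K < width ((word_image \<omega> ^^ m) (letter_word a)) \<and>
        K < height ((word_image \<omega> ^^ m) (letter_word a)))"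

definition self_similar :: "'a set \<Rightarrow> 'a config set \<Rightarrow> bool" where
  "self_similar A X \<longleftrightarrow> subshift A X \<and>
     (\<exists>\<omega>. \<omega> \<in> A \<rightarrow> words2 A \<and> expansive A \<omega> \<and> (\<forall>x\<in>X. matching \<omega> UNIV x) \<and>
          X = shift_closure (config_image \<omega> ` X))"


subsection \<open>Compatibility with concatenation\<close>

lemma pos_mono: "i \<le> j \<Longrightarrow> pos d i \<le> pos d j"
proof -
  have step: "pos d i \<le> pos d (i + 1)" for i
  proof (cases "0 \<le> i")
    case True
    then have "{0..<i + 1} = insert i {0..<i}" by auto
    with True show ?thesis by (simp add: pos_def)
  next
    case False
    then have "{i..<0} = insert i {i + 1..<0}" by auto
    with False show ?thesis by (cases "i = -1") (auto simp: pos_def)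
  qed
  show "i \<le> j \<Longrightarrow> pos d i \<le> pos d j"
  proof (induction j rule: int_ge_induct)
    case (step k)
    then show ?case using \<open>\<And>i. pos d i \<le> pos d (i + 1)\<close>[of k] by linarith
  qed simp
qed

lemma locate_eq:
  assumes "pos d i \<le> p" "p < pos d (i + 1)"
  shows "locate d p = i"
  unfolding locate_def
proof (rule the_equality)
  fix k assume k: "pos d k \<le> p \<and> p < pos d (k + 1)"
  have "\<not> k < i" using pos_mono[of "k + 1" i d] k assms by force
  moreover have "\<not> i < k" using pos_mono[of "i + 1" k d] k assms by force
  ultimately show "k = i" by simp
qed (use assms in simp)

lemma locate_exists:
  assumes "0 \<le> p" "p < pos d (int n)"
  obtains i where "0 \<le> i" "i < int n" "pos d i \<le> p" "p < pos d (i + 1)"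
proof -
  have "\<exists>i\<ge>0. i < int n \<and> pos d i \<le> p \<and> p < pos d (i + 1)" using assms(2)
  proof (induction n)
    case 0
    then show ?case using assms(1) by (simp add: pos_def)
  next
    case (Suc n)
    show ?case
    proof (cases "p < pos d (int n)")
      case True
      then show ?thesis using Suc.IH by force
    next
      case False
      then show ?thesis using Suc.prems by (intro exI[of _ "int n"]) (auto simp: add.commute)
    qed
  qed
  then show ?thesis using that by blast
qed

lemma pos_cong: "(\<And>k. 0 \<le> k \<Longrightarrow> k < i \<Longrightarrow> d k = e k) \<Longrightarrow> 0 \<le> i \<Longrightarrow> pos d i = pos e i"
  by (auto simp: pos_def intro: sum.cong)

lemma pos_add:
  assumes "\<And>k. 0 \<le> k \<Longrightarrow> k < i \<Longrightarrow> d (n + k) = e k" "0 \<le> n" "0 \<le> i"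
  shows "pos d (n + i) = pos d n + pos e i"
proof -
  have "{0..<n + i} = {0..<n} \<union> {n..<n + i}" using assms by auto
  then have "(\<Sum>k\<in>{0..<n + i}. int (d k)) = (\<Sum>k\<in>{0..<n}. int (d k)) + (\<Sum>k\<in>{n..<n + i}. int (d k))"
    by (simp add: sum.union_disjoint)
  also have "(\<Sum>k\<in>{n..<n + i}. int (d k)) = (\<Sum>k\<in>{0..<i}. int (e k))"
  proof (rule sum.reindex_bij_witness[of _ "\<lambda>k. n + k" "\<lambda>k. k - n"])
    fix k assume "k \<in> {n..<n + i}"
    then show "int (e (k - n)) = int (d k)" using assms(1)[of "k - n"] by simp
  qed auto
  finally show ?thesis using assms by (simp add: pos_def)
qed

lemma matching_rect:
  assumes "matching \<omega> (rect n) x" "(i, j) \<in> rect n"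
  shows "height (\<omega> (x (i, j))) = row_height \<omega> x j" "width (\<omega> (x (i, j))) = col_width \<omega> x i"
proof -
  have "0 \<le> i" "0 \<le> j" using assms(2) by (auto simp: rect_def)
  have "(i, j) \<in> rect n \<longrightarrow> height (\<omega> (x (i, j))) = row_height \<omega> x j" using \<open>0 \<le> i\<close>
  proof (induction i rule: int_ge_induct)
    case (step i)
    show ?case
    proof
      assume *: "(i + 1, j) \<in> rect n"
      with step.hyps have "(i, j) \<in> rect n" by (auto simp: rect_def)
      with * step.IH assms(1) show "height (\<omega> (x (i + 1, j))) = row_height \<omega> x j"
        unfolding matching_def by metis
    qed
  qed (simp add: row_height_def)
  with assms(2) show "height (\<omega> (x (i, j))) = row_height \<omega> x j" by blast
  have "(i, j) \<in> rect n \<longrightarrow> width (\<omega> (x (i, j))) = col_width \<omega> x i" using \<open>0 \<le> j\<close>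
  proof (induction j rule: int_ge_induct)
    case (step j)
    show ?case
    proof
      assume *: "(i, j + 1) \<in> rect n"
      with step.hyps have "(i, j) \<in> rect n" by (auto simp: rect_def)
      with * step.IH assms(1) show "width (\<omega> (x (i, j + 1))) = col_width \<omega> x i"
        unfolding matching_def by metis
    qed
  qed (simp add: col_width_def)
  with assms(2) show "width (\<omega> (x (i, j))) = col_width \<omega> x i" by blast
qed

lemma config_image_eq:
  assumes "pos (col_width \<omega> x) i \<le> p" "p < pos (col_width \<omega> x) (i + 1)"
    and "pos (row_height \<omega> x) j \<le> q" "q < pos (row_height \<omega> x) (j + 1)"
  shows "config_image \<omega> x (p, q) =
    letters (\<omega> (x (i, j))) (p - pos (col_width \<omega> x) i, q - pos (row_height \<omega> x) j)"
  using assms by (simp add: config_image_def Let_def locate_eq)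

theorem word_image_hcat:
  fixes u v :: "'a word2" and \<omega> :: "'a \<Rightarrow> 'b word2"
  assumes "word_defined \<omega> (u \<odot>\<^sup>1 v)" "0 < width u" "0 < width v" "height u = height v"
  shows "word_defined \<omega> u" "word_defined \<omega> v"
    and "height (word_image \<omega> u) = height (word_image \<omega> v)"
    and "word_image \<omega> (u \<odot>\<^sup>1 v) = word_image \<omega> u \<odot>\<^sup>1 word_image \<omega> v"
proof -
  define w where "w = u \<odot>\<^sup>1 v"
  define n m h where nmh: "n = int (width u)" "m = int (width v)" "h = int (height u)"
  have sh: "int (width w) = n + m" "int (height w) = h" "int (height v) = h"
    using assms(4) by (auto simp: w_def hcat_def nmh)
  have pos0: "0 < n" "0 < m" "0 < h" using assms by (auto simp: nmh hcat_def word_defined_def)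
  have u: "letters w (i, j) = letters u (i, j)" if "0 \<le> i" "i < n" "0 \<le> j" "j < h" for i j
    using that by (auto simp: w_def hcat_def nmh rect_def)
  have v: "letters w (n + i, j) = letters v (i, j)" if "0 \<le> i" "i < m" "0 \<le> j" "j < h" for i j
    using that by (auto simp: w_def hcat_def nmh rect_def)
  have ru: "(i, j) \<in> rect (fst u) \<longleftrightarrow> 0 \<le> i \<and> i < n \<and> 0 \<le> j \<and> j < h"
    and rv: "(i, j) \<in> rect (fst v) \<longleftrightarrow> 0 \<le> i \<and> i < m \<and> 0 \<le> j \<and> j < h"
    and rw: "(i, j) \<in> rect (fst w) \<longleftrightarrow> 0 \<le> i \<and> i < n + m \<and> 0 \<le> j \<and> j < h" for i j
    using sh by (auto simp: rect_def nmh)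
  have mw: "matching \<omega> (rect (fst w)) (letters w)" using assms(1) by (simp add: w_def word_defined_def)
  have mu: "matching \<omega> (rect (fst u)) (letters u)"
    unfolding matching_def
  proof (intro conjI allI impI)
    fix i j assume a: "(i, j) \<in> rect (fst u) \<and> (i + 1, j) \<in> rect (fst u)"
    then have "(i, j) \<in> rect (fst w)" "(i + 1, j) \<in> rect (fst w)" using pos0 by (auto simp: ru rw)
    then have "height (\<omega> (letters w (i, j))) = height (\<omega> (letters w (i + 1, j)))"
      using mw unfolding matching_def by blast
    then show "height (\<omega> (letters u (i, j))) = height (\<omega> (letters u (i + 1, j)))"
      using a by (simp add: ru u)
  next
    fix i j assume a: "(i, j) \<in> rect (fst u) \<and> (i, j + 1) \<in> rect (fst u)"
    then have "(i, j) \<in> rect (fst w)" "(i, j + 1) \<in> rect (fst w)" using pos0 by (auto simp: ru rw)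
    then have "width (\<omega> (letters w (i, j))) = width (\<omega> (letters w (i, j + 1)))"
      using mw unfolding matching_def by blast
    then show "width (\<omega> (letters u (i, j))) = width (\<omega> (letters u (i, j + 1)))"
      using a by (simp add: ru u)
  qed
  then show "word_defined \<omega> u" using pos0 by (simp add: word_defined_def nmh)
  have mv: "matching \<omega> (rect (fst v)) (letters v)"
    unfolding matching_def
  proof (intro conjI allI impI)
    fix i j assume a: "(i, j) \<in> rect (fst v) \<and> (i + 1, j) \<in> rect (fst v)"
    then have "(n + i, j) \<in> rect (fst w)" "(n + i + 1, j) \<in> rect (fst w)" using pos0 by (auto simp: rv rw)
    then have "height (\<omega> (letters w (n + i, j))) = height (\<omega> (letters w (n + i + 1, j)))"
      using mw unfolding matching_def by blast
    then show "height (\<omega> (letters v (i, j))) = height (\<omega> (letters v (i + 1, j)))"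
      using a v[of i j] v[of "i + 1" j] by (simp add: rv add.assoc)
  next
    fix i j assume a: "(i, j) \<in> rect (fst v) \<and> (i, j + 1) \<in> rect (fst v)"
    then have "(n + i, j) \<in> rect (fst w)" "(n + i, j + 1) \<in> rect (fst w)" using pos0 by (auto simp: rv rw)
    then have "width (\<omega> (letters w (n + i, j))) = width (\<omega> (letters w (n + i, j + 1)))"
      using mw unfolding matching_def by blast
    then show "width (\<omega> (letters v (i, j))) = width (\<omega> (letters v (i, j + 1)))"
      using a by (simp add: rv v)
  qed
  then show "word_defined \<omega> v" using pos0 assms(4) by (simp add: word_defined_def nmh)
  let ?cu = "col_width \<omega> (letters u)" and ?cv = "col_width \<omega> (letters v)"
    and ?cw = "col_width \<omega> (letters w)"
  let ?ru = "row_height \<omega> (letters u)" and ?rv = "row_height \<omega> (letters v)"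
    and ?rw = "row_height \<omega> (letters w)"
  have r1: "?rw j = ?ru j" "?rw j = ?rv j" if "0 \<le> j" "j < h" for j
    using u[of 0 j] v[of 0 j] that pos0 matching_rect(1)[OF mw, of n j]
    by (auto simp: row_height_def rw)
  have c1: "?cw i = ?cu i" if "0 \<le> i" "i < n" for i
    using u[of i 0] that pos0 by (simp add: col_width_def)
  have c2: "?cw (n + i) = ?cv i" if "0 \<le> i" "i < m" for i
    using v[of i 0] that pos0 by (simp add: col_width_def)
  have R: "pos ?rw j = pos ?ru j" "pos ?rw j = pos ?rv j" if "0 \<le> j" "j \<le> h" for j
    using that r1 by (auto intro!: pos_cong)
  have C1: "pos ?cw i = pos ?cu i" if "0 \<le> i" "i \<le> n" for i
    using that c1 by (auto intro!: pos_cong)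
  have C2: "pos ?cw (n + i) = pos ?cu n + pos ?cv i" if "0 \<le> i" "i \<le> m" for i
    using that pos_add[of i ?cw n ?cv] c2 C1[of n] pos0 by auto
  show ht: "height (word_image \<omega> u) = height (word_image \<omega> v)"
    using R[of h] pos0 by (simp add: word_image_def Let_def sh flip: nmh)
  have nonneg: "0 \<le> pos d k" if "0 \<le> k" for d and k :: int
    using that pos_mono[of 0 k d] by (simp add: pos_def)
  define N where "N = nat (pos ?cu n)"
  define M where "M = nat (pos ?cv m)"
  define H where "H = nat (pos ?ru h)"
  have NMH: "int N = pos ?cu n" "int M = pos ?cv m" "int H = pos ?ru h"
    using nonneg pos0 by (auto simp: N_def M_def H_def)
  have iu: "word_image \<omega> u = ((N, H), restrict (config_image \<omega> (letters u)) (rect (N, H)))"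
    by (simp add: word_image_def Let_def N_def H_def nmh)
  have iv: "word_image \<omega> v = ((M, H), restrict (config_image \<omega> (letters v)) (rect (M, H)))"
    using R[of h] pos0 by (simp add: word_image_def Let_def M_def H_def sh flip: nmh)
  have "nat (pos ?cw (n + m)) = N + M" "nat (pos ?rw h) = H"
    using C2[of m] R[of h] pos0 NMH by auto
  then have iw: "word_image \<omega> w = ((N + M, H), restrict (config_image \<omega> (letters w)) (rect (N + M, H)))"
    by (simp add: word_image_def Let_def sh)
  have key: "config_image \<omega> (letters w) (p, q) =
     (if p < int N then config_image \<omega> (letters u) (p, q)
      else config_image \<omega> (letters v) (p - int N, q))"
    if pq: "0 \<le> p" "p < int (N + M)" "0 \<le> q" "q < int H" for p q
  proof -
    obtain j where j: "0 \<le> j" "j < h" "pos ?ru j \<le> q" "q < pos ?ru (j + 1)"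
      using locate_exists[of q ?ru "height u", folded nmh] pq NMH by metis
    have Rj: "pos ?rw j = pos ?ru j" "pos ?rw (j + 1) = pos ?ru (j + 1)"
      "pos ?rv j = pos ?ru j" "pos ?rv (j + 1) = pos ?ru (j + 1)"
      using R[of j] R[of "j + 1"] j by auto
    show ?thesis
    proof (cases "p < int N")
      case True
      obtain i where i: "0 \<le> i" "i < n" "pos ?cu i \<le> p" "p < pos ?cu (i + 1)"
        using locate_exists[of p ?cu "width u", folded nmh] pq True NMH by metis
      have Ci: "pos ?cw i = pos ?cu i" "pos ?cw (i + 1) = pos ?cu (i + 1)"
        using C1[of i] C1[of "i + 1"] i by auto
      show ?thesis using True i j Ci Rj u[of i j]
        by (simp add: config_image_eq[of \<omega> _ i p j q])
    next
      case False
      obtain i where i: "0 \<le> i" "i < m" "pos ?cv i \<le> p - int N" "p - int N < pos ?cv (i + 1)"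
        using locate_exists[of "p - int N" ?cv "width v", folded nmh] pq False NMH by force
      have Ci: "pos ?cw (n + i) = int N + pos ?cv i" "pos ?cw (n + i + 1) = int N + pos ?cv (i + 1)"
        using C2[of i] C2[of "i + 1"] i NMH by (auto simp: add.assoc)
      have "config_image \<omega> (letters w) (p, q) =
          letters (\<omega> (letters w (n + i, j))) (p - pos ?cw (n + i), q - pos ?rw j)"
        by (rule config_image_eq) (use i j Ci Rj in auto)
      moreover have "config_image \<omega> (letters v) (p - int N, q) =
          letters (\<omega> (letters v (i, j))) (p - int N - pos ?cv i, q - pos ?rv j)"
        by (rule config_image_eq) (use i j Ci Rj in auto)
      ultimately show ?thesis using False i j Ci Rj v[of i j] by (simp add: algebra_simps)
    qed
  qed
  show "word_image \<omega> (u \<odot>\<^sup>1 v) = word_image \<omega> u \<odot>\<^sup>1 word_image \<omega> v"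
    unfolding w_def[symmetric] iw iu iv hcat_def[of "((N, H), _)"]
    by (auto simp: restrict_def rect_def key intro!: ext)
qed

text \<open>The vertical case follows by transposition.\<close>

definition transp2 :: "'a word2 \<Rightarrow> 'a word2" where
  "transp2 u = (prod.swap (fst u), letters u \<circ> prod.swap)"

lemma transp2_simps [simp]:
  "width (transp2 u) = height u" "height (transp2 u) = width u"
  "letters (transp2 u) (i, j) = letters u (j, i)" "transp2 (transp2 u) = u"
  by (simp_all add: transp2_def prod_eq_iff fun_eq_iff)

lemma config_image_transp2:
  "config_image (transp2 \<circ> \<omega>) (letters (transp2 u)) (p, q) = config_image \<omega> (letters u) (q, p)"
  and col_width_transp2: "col_width (transp2 \<circ> \<omega>) (letters (transp2 u)) = row_height \<omega> (letters u)"
  and row_height_transp2: "row_height (transp2 \<circ> \<omega>) (letters (transp2 u)) = col_width \<omega> (letters u)"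
proof -
  show c: "col_width (transp2 \<circ> \<omega>) (letters (transp2 u)) = row_height \<omega> (letters u)"
    and r: "row_height (transp2 \<circ> \<omega>) (letters (transp2 u)) = col_width \<omega> (letters u)"
    by (simp_all add: fun_eq_iff col_width_def row_height_def)
  show "config_image (transp2 \<circ> \<omega>) (letters (transp2 u)) (p, q) = config_image \<omega> (letters u) (q, p)"
    by (simp add: config_image_def Let_def c r)
qed

lemma word_image_transp2: "word_image (transp2 \<circ> \<omega>) (transp2 u) = transp2 (word_image \<omega> u)"
  by (auto simp: word_image_def Let_def config_image_transp2 col_width_transp2 row_height_transp2
      transp2_def[of "(_, _)"] rect_def intro!: ext)

lemma word_defined_transp2: "word_defined (transp2 \<circ> \<omega>) (transp2 u) \<longleftrightarrow> word_defined \<omega> u"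
proof -
  have "(i, j) \<in> rect (fst (transp2 u)) \<longleftrightarrow> (j, i) \<in> rect (fst u)" for i j
    by (auto simp: rect_def)
  then show ?thesis by (auto simp: word_defined_def matching_def)
qed

lemma vcat_transp2:
  "width u = width v \<Longrightarrow> u \<odot>\<^sup>2 v = transp2 (transp2 u \<odot>\<^sup>1 transp2 v)"
  by (auto simp: vcat_def hcat_def transp2_def[of "(_, _)"] rect_def intro!: ext)

theorem word_image_vcat:
  fixes u v :: "'a word2" and \<omega> :: "'a \<Rightarrow> 'b word2"
  assumes "word_defined \<omega> (u \<odot>\<^sup>2 v)" "0 < height u" "0 < height v" "width u = width v"
  shows "word_defined \<omega> u" "word_defined \<omega> v"
    and "width (word_image \<omega> u) = width (word_image \<omega> v)"
    and "word_image \<omega> (u \<odot>\<^sup>2 v) = word_image \<omega> u \<odot>\<^sup>2 word_image \<omega> v"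
proof -
  let ?t = "transp2 \<circ> \<omega>"
  have *: "word_defined ?t (transp2 u \<odot>\<^sup>1 transp2 v)"
    using assms(1,4) word_defined_transp2[of \<omega> "u \<odot>\<^sup>2 v"] by (simp add: vcat_transp2)
  note h = word_image_hcat[OF *, simplified, OF assms(2-4)]
  show "word_defined \<omega> u" "word_defined \<omega> v" using h(1,2) by (simp_all add: word_defined_transp2)
  show w: "width (word_image \<omega> u) = width (word_image \<omega> v)"
    using h(3) by (simp add: word_image_transp2)
  have "word_image \<omega> (u \<odot>\<^sup>2 v) = transp2 (word_image ?t (transp2 u \<odot>\<^sup>1 transp2 v))"
    using word_image_transp2[of \<omega> "u \<odot>\<^sup>2 v"] assms(4) by (simp add: vcat_transp2)
  also have "\<dots> = word_image \<omega> u \<odot>\<^sup>2 word_image \<omega> v"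
    using h(4) w by (simp add: vcat_transp2 word_image_transp2)
  finally show "word_image \<omega> (u \<odot>\<^sup>2 v) = word_image \<omega> u \<odot>\<^sup>2 word_image \<omega> v" .
qed

theorem word_image_letter:
  assumes "\<omega> a \<in> words2 B" "0 < width (\<omega> a)" "0 < height (\<omega> a)"
  shows "word_defined \<omega> (letter_word a)" "word_image \<omega> (letter_word a) = \<omega> a"
proof -
  have a: "letters (letter_word a) (0, 0) = a" by (simp add: letter_word_def rect_def)
  show "word_defined \<omega> (letter_word a)"
    by (auto simp: word_defined_def matching_def letter_word_def rect_def)
  have one: "{0..<1::int} = {0}" by auto
  have p: "pos d 0 = 0" "pos d 1 = int (d 0)" for d by (simp_all add: pos_def one)
  have "config_image \<omega> (letters (letter_word a)) (p, q) = letters (\<omega> a) (p, q)"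
    if "0 \<le> p" "p < int (width (\<omega> a))" "0 \<le> q" "q < int (height (\<omega> a))" for p q
    using that config_image_eq[of \<omega> "letters (letter_word a)" 0 p 0 q]
    by (simp add: p a col_width_def row_height_def)
  moreover have "letters (\<omega> a) \<in> extensional (rect (fst (\<omega> a)))"
    using assms(1) by (auto simp: words2_def PiE_def split: prod.splits)
  moreover have "fst (letter_word a) = (1, 1)" by (simp add: letter_word_def)
  ultimately show "word_image \<omega> (letter_word a) = \<omega> a"
    by (auto simp: word_image_def Let_def p a col_width_def row_height_def rect_def
        prod_eq_iff extensional_def intro!: ext)
qed


section \<open>Symbolic dynamical systems on the torus\<close>

definition allowed :: "('a \<Rightarrow> 't set) \<Rightarrow> (int \<times> int \<Rightarrow> 't \<Rightarrow> 't) \<Rightarrow> (int \<times> int) set \<Rightarrow> 'a config \<Rightarrow> bool" where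
  "allowed P R S w \<longleftrightarrow> (\<Inter>k\<in>S. R k -` P (w k)) \<noteq> {}"

definition symbolic_system :: "'a set \<Rightarrow> ('a \<Rightarrow> 't set) \<Rightarrow> (int \<times> int \<Rightarrow> 't \<Rightarrow> 't) \<Rightarrow> 'a config set" where
  "symbolic_system A P R =
     {x. (\<forall>m. x m \<in> A) \<and> (\<forall>n S. finite S \<longrightarrow> allowed P R S (restrict (shift n x) S))}"

quotient_type torus = "real \<times> real" /
  "\<lambda>p q. fst p - fst q \<in> \<int> \<and> snd p - snd q \<in> \<int>"
  morphisms rep_torus to_torus
proof (rule equivpI)
  show "reflp (\<lambda>p q :: real \<times> real. fst p - fst q \<in> \<int> \<and> snd p - snd q \<in> \<int>)"
    by (auto intro: reflpI)
  show "symp (\<lambda>p q :: real \<times> real. fst p - fst q \<in> \<int> \<and> snd p - snd q \<in> \<int>)"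
    by (metis (mono_tags, lifting) Ints_minus minus_diff_eq sympI)
  show "transp (\<lambda>p q :: real \<times> real. fst p - fst q \<in> \<int> \<and> snd p - snd q \<in> \<int>)"
    by (intro transpI) (metis (no_types, lifting) Ints_add diff_add_cancel add_diff_eq)
qed

definition golden :: real  ("\<phi>") where
  "\<phi> = (1 + sqrt 5) / 2"

lift_definition rotation_Z :: "int \<times> int \<Rightarrow> torus \<Rightarrow> torus" is
  "\<lambda>n x. (fst x + of_int (fst n) / \<phi>^2, snd x + of_int (snd n) / \<phi>^2)"
  by simp

definition polygon_vertices :: "(real \<times> real) list list" where
  "polygon_vertices =
    [[(1/\<phi>, 1/\<phi>), (2/\<phi>^2, 1/\<phi>), (1/\<phi>, 2/\<phi>^2)],
     [(2/\<phi>^2, 1/\<phi>), (1, 1/\<phi>), (1, 1), (1/\<phi>, 1), (1/\<phi>, 2/\<phi>^2)],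
     [(1/\<phi>^3, 1/\<phi>), (1/\<phi>^2, 1/\<phi>), (0, 1)],
     [(0, 1/\<phi>), (1/\<phi>^3, 1/\<phi>), (0, 1)],
     [(1/\<phi>, 1/\<phi>), (1/\<phi>, 2/\<phi>^2), (1/\<phi>^2, 1)],
     [(1/\<phi>^2, 1), (1/\<phi>, 2/\<phi>^2), (1/\<phi>, 1)],
     [(1/\<phi>^2, 1/\<phi>), (1/\<phi>, 1/\<phi>), (1/\<phi>^2, 1), (0, 1)],
     [(1/\<phi>, 0), (1, 0), (1/\<phi>, 1/\<phi>^2)],
     [(1/\<phi>, 1/\<phi>), (1, 0), (1, 1/\<phi>^2), (2/\<phi>^2, 1/\<phi>)],
     [(2/\<phi>^2, 1/\<phi>), (1, 1/\<phi>^2), (1, 1/\<phi>)],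
     [(1/\<phi>, 1/\<phi>^2), (1, 0), (1/\<phi>, 1/\<phi>)],
     [(1/\<phi>, 0), (1/\<phi>, 1/\<phi>^2), (1/\<phi>^2, 1/\<phi>), (1/\<phi>^3, 1/\<phi>)],
     [(1/\<phi>^2, 0), (1/\<phi>, 0), (1/\<phi>^3, 1/\<phi>), (0, 1/\<phi>)],
     [(0, 0), (1/\<phi>^2, 0), (0, 1/\<phi>^2)],
     [(1/\<phi>^2, 0), (0, 1/\<phi>), (0, 1/\<phi>^2)],
     [(1/\<phi>^2, 1/\<phi>), (1/\<phi>, 1/\<phi>^2), (1/\<phi>, 1/\<phi>)]]"

definition partition_Z :: "nat \<Rightarrow> torus set" where
  "partition_Z a = to_torus ` interior (convex hull (set (polygon_vertices ! a)))"

definition X_Z :: "nat config set" where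
  "X_Z = symbolic_system {0..15} partition_Z rotation_Z"


section \<open>The morphism \<open>\<Phi>\<close>\<close>

text \<open>Matrices are listed row by row from top to bottom, whereas the second coordinate of a word
  increases upwards.\<close>

definition word_of_matrix :: "'a list list \<Rightarrow> 'a word2" where
  "word_of_matrix M =
     (let n = (length (hd M), length M)
      in (n, restrict (\<lambda>(i, j). rev M ! nat j ! nat i) (rect n)))"

definition Phi_matrices :: "nat list list list" where
  "Phi_matrices =
    [[[14]],
     [[13]],
     [[12, 10]],
     [[11, 8]],
     [[14, 7]],
     [[13, 7]],
     [[12, 7]],
     [[6],
      [12]],
     [[3],
      [14]],
     [[3],
      [13]],
     [[2],
      [12]],
     [[6, 1],
      [12, 10]],
     [[6, 1],
      [11, 8]],
     [[5, 1],
      [15, 9]],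
     [[4, 1],
      [11, 8]],
     [[2, 0],
      [12, 7]]]"

definition Phi :: "nat \<Rightarrow> nat word2"  ("\<Phi>") where
  "\<Phi> a = word_of_matrix (Phi_matrices ! a)"

end

theory Submission
  imports Defs
begin

text \<open>
  The reason for self-similarity is renormalization.  Inducing the rotation by \<open>1/\<phi>\<^sup>2\<close> on the circle
  \<open>[0, 1)\<close> to the interval \<open>[0, 1/\<phi>)\<close> gives, up to the scaling \<open>u \<mapsto> (1 - u) / \<phi>\<close>, the same rotation:
  a point \<open>u < 1/\<phi>\<close> corresponds to a point with return time 2 and a point \<open>u > 1/\<phi>\<close> to one with
  return time 1.  Applying this in both coordinates, the orbit of \<open>(u, v)\<close> becomes the orbit of
  the contracted point, restricted to its visits to \<open>[0, 1/\<phi>)\<^sup>2\<close>.  What remains is a finite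
  check: the contraction of an atom \<open>P\<^sub>a\<close> lies in the atom of the lower left letter of \<open>\<Phi> a\<close>, and
  its translates up to the return times lie in the atoms of the other letters of \<open>\<Phi> a\<close>
  (lemma \<open>letter_Phi\<close>).  So the coding of the contracted point is the image under \<open>\<Phi>\<close>
  of the coding of \<open>(u, v)\<close> (lemma \<open>config_image_coding\<close>).

  The finite checks become comparisons of numbers in \<open>\<int>[\<phi>]\<close>, because every edge of the partition
  lies on a level line of one of the four linear forms \<open>x\<close>, \<open>y\<close>, \<open>x + y\<close> and \<open>\<phi> x + y\<close>.  The
  contraction multiplies each of these forms by \<open>- 1/\<phi>\<close> and adds a constant, so it suffices to
  record the range of each form on each atom.

  To avoid the boundaries, codings are only taken of generic points, at which no form has a value
  in \<open>\<int>[\<phi>]\<close>.  Their orbits and contractions are again generic, and since \<open>\<int>[\<phi>]\<close> is countable they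
  are dense.  A finite pattern is allowed when an open set is nonempty, hence \<open>X_Z\<close> consists exactly
  of the configurations whose finite patterns all occur in codings of generic points
  (lemma \<open>X_Z_iff\<close>).  Since the image of a configuration under \<open>\<Phi>\<close> depends locally on it, \<open>X_Z\<close>
  is mapped to itself.  Conversely, a generic coding is the shift by a vector in \<open>{0, 1}\<^sup>2\<close> of the
  image of a generic coding, and compactness of the space of configurations carries this over to
  all of \<open>X_Z\<close>.
\<close>

section \<open>Arithmetic of the golden mean\<close>

lemma golden_square: "\<phi> * \<phi> = \<phi> + 1"
  by (simp add: golden_def field_simps)

text \<open>These bounds are precise enough to compare all the constants \<open>a + b * \<phi>\<close> below by linear
  arithmetic.\<close>
lemma golden_lower: "1.618 < \<phi>"
proof -
  have "sqrt (2.236 ^ 2) < sqrt 5"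
    by (rule real_sqrt_less_mono) (simp add: power2_eq_square)
  then show ?thesis by (simp add: golden_def)
qed

lemma golden_upper: "\<phi> < 1.6181"
proof -
  have "sqrt 5 < sqrt (2.2362 ^ 2)"
    by (rule real_sqrt_less_mono) (simp add: power2_eq_square)
  then show ?thesis by (simp add: golden_def)
qed

lemmas golden_bounds = golden_lower golden_upper

text \<open>Used for rewriting next to \<open>golden_square\<close>, so that products associated to the right are also
  reduced to the form \<open>a + b * \<phi>\<close>.\<close>
lemma golden_square_left: "\<phi> * (\<phi> * c) = \<phi> * c + c"
  using golden_square by (metis distrib_right mult.assoc mult_1)

lemma inverse_golden: "1 / \<phi> = \<phi> - 1"
  using golden_square golden_lower by (simp add: field_simps)

lemma divide_golden_power2: "c / \<phi>^2 = c * (2 - \<phi>)"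
  using golden_square golden_lower
  by (simp add: field_simps power2_eq_square golden_square_left)

lemma divide_golden_power3: "1 / \<phi>^3 = 2 * \<phi> - 3"
  using golden_square golden_lower
  by (simp add: field_simps power3_eq_cube golden_square_left)

section \<open>The atoms in terms of lines in four directions\<close>

text \<open>The decision tree of the partition.  The parameters \<open>s\<close> and \<open>t\<close> stand for \<open>x + y\<close> and
  \<open>\<phi> * x + y\<close>; as separate variables they make every condition a comparison of one variable with a
  constant.  The lines \<open>x = 1/\<phi>\<close> and \<open>y = 1/\<phi>\<close> cut the unit square into four rectangles, and within each
  of them the lines of slopes \<open>-1\<close> and \<open>-\<phi>\<close> do not cross, so that the atoms are passed one after
  the other.\<close>
definition letter_of :: "real \<Rightarrow> real \<Rightarrow> real \<Rightarrow> real \<Rightarrow> nat" where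
  "letter_of x y s t =
     (if x < \<phi> - 1 then
        if y < \<phi> - 1 then
          if s < 2 - \<phi> then 13 else if t < \<phi> - 1 then 14 else if t < 1 then 12
          else if s < 1 then 11 else 15
        else
          if t < 1 then 3 else if s < 1 then 2 else if t < \<phi> then 6
          else if s < 3 - \<phi> then 4 else 5
      else
        if y < \<phi> - 1 then
          if s < 1 then 7 else if t < \<phi> then 10 else if s < 3 - \<phi> then 8 else 9
        else
          if s < 3 - \<phi> then 0 else 1)"

definition letter :: "real \<Rightarrow> real \<Rightarrow> nat" where
  "letter x y = letter_of x y (x + y) (\<phi> * x + y)"

text \<open>The row of a letter \<open>a\<close> holds the least and the greatest value of \<open>x\<close>, \<open>y\<close>, \<open>x + y\<close> and
  \<open>\<phi> * x + y\<close> on the vertices of \<open>P\<^sub>a\<close>.\<close>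
definition strip_bounds :: "(real \<times> real) list list" where
  "strip_bounds =
    [[(\<phi> - 1, 4 - 2 * \<phi>), (\<phi> - 1, 4 - 2 * \<phi>), (2 * \<phi> - 2, 3 - \<phi>), (\<phi>, 3 * \<phi> - 3)],
     [(\<phi> - 1, 1), (\<phi> - 1, 1), (3 - \<phi>, 2), (5 - 2 * \<phi>, \<phi> + 1)],
     [(0, 2 - \<phi>), (\<phi> - 1, 1), (3 * \<phi> - 4, 1), (1, 2 * \<phi> - 2)],
     [(0, 2 * \<phi> - 3), (\<phi> - 1, 1), (\<phi> - 1, 1), (\<phi> - 1, 1)],
     [(2 - \<phi>, \<phi> - 1), (\<phi> - 1, 1), (2 * \<phi> - 2, 3 - \<phi>), (\<phi>, 5 - 2 * \<phi>)],
     [(2 - \<phi>, \<phi> - 1), (4 - 2 * \<phi>, 1), (3 - \<phi>, \<phi>), (\<phi>, 2)],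
     [(0, \<phi> - 1), (\<phi> - 1, 1), (1, 3 - \<phi>), (1, \<phi>)],
     [(\<phi> - 1, 1), (0, 2 - \<phi>), (\<phi> - 1, 1), (1, \<phi>)],
     [(\<phi> - 1, 1), (0, \<phi> - 1), (1, 3 - \<phi>), (\<phi>, 2)],
     [(4 - 2 * \<phi>, 1), (2 - \<phi>, \<phi> - 1), (3 - \<phi>, \<phi>), (3 * \<phi> - 3, 2 * \<phi> - 1)],
     [(\<phi> - 1, 1), (0, \<phi> - 1), (1, 2 * \<phi> - 2), (3 - \<phi>, \<phi>)],
     [(2 * \<phi> - 3, \<phi> - 1), (0, \<phi> - 1), (\<phi> - 1, 1), (1, 3 - \<phi>)],
     [(0, \<phi> - 1), (0, \<phi> - 1), (2 - \<phi>, 3 * \<phi> - 4), (\<phi> - 1, 1)],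
     [(0, 2 - \<phi>), (0, 2 - \<phi>), (0, 2 - \<phi>), (0, \<phi> - 1)],
     [(0, 2 - \<phi>), (0, \<phi> - 1), (2 - \<phi>, \<phi> - 1), (2 - \<phi>, \<phi> - 1)],
     [(2 - \<phi>, \<phi> - 1), (2 - \<phi>, \<phi> - 1), (1, 2 * \<phi> - 2), (2 * \<phi> - 2, \<phi>)]]"

definition in_strips :: "nat \<Rightarrow> real \<Rightarrow> real \<Rightarrow> real \<Rightarrow> real \<Rightarrow> bool" where
  "in_strips a x y s t \<longleftrightarrow>
     list_all2 (\<lambda>(l, u) z. l < z \<and> z < u) (strip_bounds ! a) [x, y, s, t]"

lemma all_letters: "(\<forall>a\<le>15. P a) \<longleftrightarrow>
  P 0 \<and> P 1 \<and> P 2 \<and> P 3 \<and> P 4 \<and> P 5 \<and> P 6 \<and> P 7 \<and> P 8 \<and> P 9 \<and> P 10 \<and> P 11 \<and>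
  P 12 \<and> P 13 \<and> P 14 \<and> P (15 :: nat)"
proof -
  have "a \<le> 15 \<longleftrightarrow> a < Suc (Suc (Suc (Suc (Suc (Suc (Suc (Suc (Suc (Suc (Suc (Suc (Suc (Suc (Suc (Suc 0)))))))))))))))" for a :: nat
    by auto
  then show ?thesis by (simp only: All_less_Suc) (simp add: eval_nat_numeral conj_ac)
qed

text \<open>The ranges determine the letter because two disjoint convex polygons are separated by the line of an
  edge, and all edges have one of the four directions.  Treating \<open>s\<close> and \<open>t\<close> as independent of \<open>x\<close> and \<open>y\<close>
  keeps the arithmetic linear.\<close>
lemma letter_of_in_strips:
  assumes "a \<le> 15" "in_strips a x y s t"
  shows "letter_of x y s t = a"
proof -
  have "\<forall>a\<le>15. in_strips a x y s t \<longrightarrow> letter_of x y s t = a"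
    unfolding all_letters using golden_bounds
    by (intro conjI impI; simp add: in_strips_def strip_bounds_def letter_of_def)
  with assms show ?thesis by blast
qed

lemma interior_convex_hull_less:
  fixes n :: "'a :: euclidean_space"
  assumes "n \<noteq> 0" "\<And>v. v \<in> V \<Longrightarrow> n \<bullet> v \<le> c" "p \<in> interior (convex hull V)"
  shows "n \<bullet> p < c"
proof -
  have "convex hull V \<subseteq> {x. n \<bullet> x \<le> c}"
    using assms(2) by (intro hull_minimal) (auto simp: convex_halfspace_le)
  then have "interior (convex hull V) \<subseteq> {x. n \<bullet> x < c}"
    using interior_mono interior_halfspace_le[OF assms(1), of c] by metis
  with assms(3) show ?thesis by auto
qed

lemma interior_polygon_in_strips:
  assumes "a \<le> 15" "(x, y) \<in> interior (convex hull (set (polygon_vertices ! a)))"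
  shows "in_strips a x y (x + y) (\<phi> * x + y)"
proof -
  define confined where "confined b = (\<lambda>(l, u) (m, n). (m, n) \<noteq> (0, 0) \<and>
      (\<forall>(v, w) \<in> set (polygon_vertices ! b). l \<le> m * v + n * w \<and> m * v + n * w \<le> u))"
    for b and m n :: real
  have "\<forall>b\<le>15. list_all2 (confined b) (strip_bounds ! b) [(1, 0), (0, 1), (1, 1), (\<phi>, 1)]"
    unfolding all_letters confined_def using golden_bounds
    by (intro conjI; simp add: strip_bounds_def polygon_vertices_def inverse_golden
        divide_golden_power2 divide_golden_power3 algebra_simps golden_square golden_square_left)
  then have "list_all2 (confined a) (strip_bounds ! a) [(1, 0), (0, 1), (1, 1), (\<phi>, 1)]"
    using assms(1) by blast
  then have "list_all2 (\<lambda>(l, u) (m, n). l < m * x + n * y \<and> m * x + n * y < u)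
      (strip_bounds ! a) [(1, 0), (0, 1), (1, 1), (\<phi>, 1)]"
  proof (rule list_all2_mono, clarify)
    fix l u m n assume *: "confined a (l, u) (m, n)"
    then show "l < m * x + n * y \<and> m * x + n * y < u"
      using interior_convex_hull_less[OF _ _ assms(2), of "(m, n)" u]
        interior_convex_hull_less[OF _ _ assms(2), of "(- m, - n)" "- l"]
      by (force simp: zero_prod_def confined_def)
  qed
  then have "list_all2 (\<lambda>(l, u) z. l < z \<and> z < u)
      (strip_bounds ! a) (map (\<lambda>(m, n). m * x + n * y) [(1, 0), (0, 1), (1, 1), (\<phi>, 1)])"
    unfolding list_all2_map2 by (rule list_all2_mono) auto
  then show ?thesis by (simp add: in_strips_def)
qed

definition orient :: "real \<times> real \<Rightarrow> real \<times> real \<Rightarrow> real \<times> real \<Rightarrow> real" where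
  "orient a b c = (fst b - fst a) * (snd c - snd a) - (snd b - snd a) * (fst c - fst a)"

fun left_of_path :: "real \<times> real \<Rightarrow> (real \<times> real) list \<Rightarrow> bool" where
  "left_of_path p (v # w # ws) \<longleftrightarrow> 0 < orient v w p \<and> left_of_path p (w # ws)"
| "left_of_path p _ \<longleftrightarrow> True"

text \<open>The polygon is cut into triangles by the diagonals from \<open>v\<close>.  The sign of \<open>orient v u p\<close>, as \<open>u\<close>
  runs through the vertices, changes from nonnegative to negative at some edge \<open>w u\<close>, and \<open>p\<close> lies in the
  triangle \<open>v w u\<close>: its barycentric coordinates are the three orientations divided by their sum.\<close>
lemma mem_convex_hull_fan:
  assumes "0 \<le> orient v w p" "left_of_path p (w # ws @ [v])" "ws \<noteq> []"
  shows "p \<in> convex hull (set (v # w # ws))"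
  using assms
proof (induction ws arbitrary: w)
  case (Cons u ws)
  have step: "0 < orient w u p" "left_of_path p (u # ws @ [v])" using Cons.prems(2) by auto
  show ?case
  proof (cases "0 \<le> orient v u p \<and> ws \<noteq> []")
    case True
    then have "p \<in> convex hull (set (v # u # ws))"
      using step(2) by (intro Cons.IH) auto
    then show ?thesis using hull_mono[of "set (v # u # ws)" "set (v # w # u # ws)"] by auto
  next
    case False
    have swap: "orient u v p = - orient v u p" by (simp add: orient_def algebra_simps)
    have nonneg: "0 \<le> orient u v p" using False step(2) by (cases "ws = []") (auto simp: swap)
    \<comment> \<open>twice the signed area of the triangle \<open>v w u\<close>\<close>
    define D where "D = orient v w p + orient w u p + orient u v p"
    have D: "0 < D" using Cons.prems(1) step nonneg by (simp add: D_def)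
    have "D *\<^sub>R p = orient w u p *\<^sub>R v + orient u v p *\<^sub>R w + orient v w p *\<^sub>R u"
      by (simp add: D_def orient_def prod_eq_iff algebra_simps)
    then have "inverse D *\<^sub>R D *\<^sub>R p =
        inverse D *\<^sub>R (orient w u p *\<^sub>R v + orient u v p *\<^sub>R w + orient v w p *\<^sub>R u)" by simp
    then have "p = (orient w u p / D) *\<^sub>R v + (orient u v p / D) *\<^sub>R w + (orient v w p / D) *\<^sub>R u"
      using D by (simp add: scaleR_add_right divide_inverse mult.commute)
    moreover have "orient w u p / D + orient u v p / D + orient v w p / D = 1"
      using D by (simp add: D_def flip: add_divide_distrib)
    ultimately have "p \<in> convex hull {v, w, u}"
      unfolding convex_hull_3 using D Cons.prems(1) step nonneg by fastforce
    then show ?thesis using hull_mono[of "{v, w, u}" "set (v # w # u # ws)"] by auto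
  qed
qed simp

lemma open_left_of_path: "open {p. left_of_path p vs}"
proof (induction vs rule: induct_list012)
  case (3 v w vs)
  have "open {p. 0 < orient v w p}"
    unfolding orient_def by (intro open_Collect_less continuous_intros)
  then show ?case using open_Int[OF _ 3(2)] by (simp add: Collect_conj_eq)
qed simp_all

lemma left_of_path_interior:
  assumes "left_of_path p (vs @ [hd vs])" "3 \<le> length vs"
  shows "p \<in> interior (convex hull (set vs))"
proof -
  obtain v w u ws where vs: "vs = v # w # u # ws"
    using assms(2) by (metis Suc_le_length_iff numeral_3_eq_3)
  have "{p. left_of_path p (vs @ [hd vs])} \<subseteq> convex hull (set vs)"
  proof clarify
    fix a b assume *: "left_of_path (a, b) (vs @ [hd vs])"
    show "(a, b) \<in> convex hull (set vs)"
      using mem_convex_hull_fan[of v w "(a, b)" "u # ws"] * vs by simp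
  qed
  then show ?thesis
    using interior_maximal[OF _ open_left_of_path] assms(1) by blast
qed

text \<open>For an edge on a level line of one of the four forms the orientation is a multiple of the
  difference between the value of the form at the point and its value on the edge, so that
  its sign is decided by the conditions in \<open>letter_of\<close>.\<close>
lemma orient_pos_horizontal:
  "d = b \<Longrightarrow> 0 < orient (a, b) (c, d) (x, y) \<longleftrightarrow> a < c \<and> b < y \<or> c < a \<and> y < b"
  by (auto simp: orient_def zero_less_mult_iff)

lemma orient_pos_vertical:
  "c = a \<Longrightarrow> 0 < orient (a, b) (c, d) (x, y) \<longleftrightarrow> b < d \<and> x < a \<or> d < b \<and> a < x"
  by (auto simp: orient_def mult_less_0_iff)

lemma orient_pos_diagonal:
  assumes "c + d = a + b"
  shows "0 < orient (a, b) (c, d) (x, y) \<longleftrightarrow> a < c \<and> a + b < x + y \<or> c < a \<and> x + y < a + b"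
proof -
  have d: "d = a + b - c" using assms by simp
  have "orient (a, b) (c, d) (x, y) = (c - a) * ((x + y) - (a + b))"
    unfolding orient_def d by (simp add: algebra_simps)
  then show ?thesis by (auto simp: zero_less_mult_iff)
qed

lemma orient_pos_golden:
  assumes "\<phi> * c + d = \<phi> * a + b"
  shows "0 < orient (a, b) (c, d) (x, y) \<longleftrightarrow>
    a < c \<and> \<phi> * a + b < \<phi> * x + y \<or> c < a \<and> \<phi> * x + y < \<phi> * a + b"
proof -
  have d: "d = \<phi> * a + b - \<phi> * c" using assms by simp
  have "orient (a, b) (c, d) (x, y) = (c - a) * ((\<phi> * x + y) - (\<phi> * a + b))"
    unfolding orient_def d by (simp add: algebra_simps)
  then show ?thesis by (auto simp: zero_less_mult_iff)
qed

text \<open>The conditions met in the decision tree, made strict by genericity, include those of all edges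
  of the polygon.\<close>
lemma letter_interior_polygon:
  assumes "0 < x" "x < 1" "0 < y" "y < 1" "x \<noteq> \<phi> - 1" "y \<noteq> \<phi> - 1"
    and "x + y \<notin> {2 - \<phi>, 1, 3 - \<phi>}" "\<phi> * x + y \<notin> {\<phi> - 1, 1, \<phi>}"
  shows "(x, y) \<in> interior (convex hull (set (polygon_vertices ! letter x y)))"
proof -
  have "\<forall>b\<le>15. letter x y = b \<longrightarrow>
      left_of_path (x, y) (polygon_vertices ! b @ [hd (polygon_vertices ! b)]) \<and>
      3 \<le> length (polygon_vertices ! b)"
    unfolding all_letters
    apply (intro conjI impI; simp only: letter_def letter_of_def split: if_splits; simp?)
    using assms golden_bounds
    apply (simp_all add: polygon_vertices_def inverse_golden divide_golden_power2
        divide_golden_power3 orient_pos_horizontal orient_pos_vertical orient_pos_diagonal)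
    apply (simp_all add: orient_pos_golden algebra_simps golden_square golden_square_left)
    done
  moreover have "letter x y \<le> 15" by (simp add: letter_def letter_of_def)
  ultimately show ?thesis using left_of_path_interior by blast
qed

lemma contracted_bounds:
  "l < c - \<phi> * z \<longleftrightarrow> z < (c - l) * (\<phi> - 1)" "c - \<phi> * z < u \<longleftrightarrow> (c - u) * (\<phi> - 1) < z"
proof -
  have *: "\<phi> * ((c - k) * (\<phi> - 1)) = c - k" for k
    by (simp add: algebra_simps golden_square golden_square_left)
  have "0 < \<phi>" using golden_bounds by simp
  have "l < c - \<phi> * z \<longleftrightarrow> \<phi> * z < \<phi> * ((c - l) * (\<phi> - 1))"
    "c - \<phi> * z < u \<longleftrightarrow> \<phi> * ((c - u) * (\<phi> - 1)) < \<phi> * z" unfolding * by auto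
  then show "l < c - \<phi> * z \<longleftrightarrow> z < (c - l) * (\<phi> - 1)"
    "c - \<phi> * z < u \<longleftrightarrow> (c - u) * (\<phi> - 1) < z"
    by (simp_all only: mult_less_cancel_left_pos[OF \<open>0 < \<phi>\<close>])
qed

lemma Phi_size:
  "width (\<Phi> a) = length (hd (Phi_matrices ! a))" "height (\<Phi> a) = length (Phi_matrices ! a)"
  by (simp_all add: Phi_def word_of_matrix_def Let_def)

lemma letters_Phi:
  "k < width (\<Phi> a) \<Longrightarrow> l < height (\<Phi> a) \<Longrightarrow>
    letters (\<Phi> a) (int k, int l) = rev (Phi_matrices ! a) ! l ! k"
  by (simp add: Phi_def word_of_matrix_def Let_def rect_def)

text \<open>The finite check behind the theorem.  The point \<open>(x, y)\<close> is the contraction of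
  \<open>(1 - \<phi> * x, 1 - \<phi> * y)\<close>, whose letter is \<open>a\<close>.  The four forms at the contracted point are
  confined to the contracted ranges, which by the row of \<open>a\<close> in the table decide the letter of
  every translate of the point within the block \<open>\<Phi> a\<close>.\<close>
lemma letter_Phi:
  fixes x y
  defines "a \<equiv> letter (1 - \<phi> * x) (1 - \<phi> * y)"
  assumes strips: "\<exists>a\<le>15. in_strips a (1 - \<phi> * x) (1 - \<phi> * y)
      ((1 - \<phi> * x) + (1 - \<phi> * y)) (\<phi> * (1 - \<phi> * x) + (1 - \<phi> * y))"
    and kl: "k < width (\<Phi> a)" "l < height (\<Phi> a)"
  shows "letter (x + k / \<phi>^2) (y + l / \<phi>^2) = letters (\<Phi> a) (k, l)"
proof -
  define s t where "s = x + y" and "t = \<phi> * x + y"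
  have contract: "in_strips b (1 - \<phi> * x) (1 - \<phi> * y) (2 - \<phi> * s) (\<phi> + 1 - \<phi> * t) \<longleftrightarrow>
      list_all2 (\<lambda>(l, u) (c, z). (c - u) * (\<phi> - 1) < z \<and> z < (c - l) * (\<phi> - 1))
        (strip_bounds ! b) [(1, x), (1, y), (2, s), (\<phi> + 1, t)]" for b
  proof -
    have eq: "[1 - \<phi> * x, 1 - \<phi> * y, 2 - \<phi> * s, \<phi> + 1 - \<phi> * t] =
        map (\<lambda>(c, z). c - \<phi> * z) [(1, x), (1, y), (2, s), (\<phi> + 1, t)]" by simp
    show ?thesis unfolding in_strips_def eq list_all2_map2
      by (rule arg_cong[where f = "\<lambda>r. list_all2 r _ _"]) (auto simp: fun_eq_iff contracted_bounds)
  qed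
  have *: "in_strips b (1 - \<phi> * x) (1 - \<phi> * y) (2 - \<phi> * s) (\<phi> + 1 - \<phi> * t) \<longrightarrow>
      (\<forall>k < length (hd (Phi_matrices ! b)). \<forall>l < length (Phi_matrices ! b).
        letter_of (x + k * (2 - \<phi>)) (y + l * (2 - \<phi>)) (s + k * (2 - \<phi>) + l * (2 - \<phi>))
          (t + k * (\<phi> - 1) + l * (2 - \<phi>)) = rev (Phi_matrices ! b) ! l ! k)" if "b \<le> 15" for b
  proof -
    have "\<forall>b\<le>15. in_strips b (1 - \<phi> * x) (1 - \<phi> * y) (2 - \<phi> * s) (\<phi> + 1 - \<phi> * t) \<longrightarrow>
      (\<forall>k < length (hd (Phi_matrices ! b)). \<forall>l < length (Phi_matrices ! b).
        letter_of (x + k * (2 - \<phi>)) (y + l * (2 - \<phi>)) (s + k * (2 - \<phi>) + l * (2 - \<phi>))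
          (t + k * (\<phi> - 1) + l * (2 - \<phi>)) = rev (Phi_matrices ! b) ! l ! k)"
      unfolding all_letters contract using golden_bounds
      apply (intro conjI impI; simp add: strip_bounds_def Phi_matrices_def All_less_Suc)
      apply (simp_all add: algebra_simps golden_square golden_square_left)
      apply (simp_all add: letter_of_def)
      done
    with that show ?thesis by blast
  qed
  obtain b where b: "b \<le> 15" "in_strips b (1 - \<phi> * x) (1 - \<phi> * y)
      ((1 - \<phi> * x) + (1 - \<phi> * y)) (\<phi> * (1 - \<phi> * x) + (1 - \<phi> * y))" using strips by blast
  have "a = b" using letter_of_in_strips[OF b] by (simp add: a_def letter_def)
  have e: "(1 - \<phi> * x) + (1 - \<phi> * y) = 2 - \<phi> * s" "\<phi> * (1 - \<phi> * x) + (1 - \<phi> * y) = \<phi> + 1 - \<phi> * t"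
    by (simp_all add: s_def t_def algebra_simps golden_square golden_square_left)
  have "letter_of (x + k * (2 - \<phi>)) (y + l * (2 - \<phi>)) (s + k * (2 - \<phi>) + l * (2 - \<phi>))
          (t + k * (\<phi> - 1) + l * (2 - \<phi>)) = rev (Phi_matrices ! a) ! l ! k"
    using *[OF b(1)] b(2) kl unfolding e \<open>a = b\<close> Phi_size by blast
  moreover have "letter (x + k / \<phi>^2) (y + l / \<phi>^2) =
      letter_of (x + k * (2 - \<phi>)) (y + l * (2 - \<phi>)) (s + k * (2 - \<phi>) + l * (2 - \<phi>))
          (t + k * (\<phi> - 1) + l * (2 - \<phi>))"
    unfolding letter_def divide_golden_power2 s_def t_def
    by (simp add: algebra_simps golden_square_left)
  ultimately show ?thesis using kl by (simp add: letters_Phi)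
qed

section \<open>Generic points and their codings\<close>

text \<open>The ring \<open>\<int>[\<phi>]\<close>, which contains the constants of all boundary lines and the rotation angle and
  of which \<open>\<phi>\<close> is a unit.\<close>
definition golden_ring :: "real set" where
  "golden_ring = {of_int a + of_int b * \<phi> | a b. True}"

lemma golden_ring_of_int [simp, intro]: "of_int n \<in> golden_ring"
  unfolding golden_ring_def by (rule CollectI, rule exI[of _ n], rule exI[of _ 0]) simp

lemma golden_ring_add: "x \<in> golden_ring \<Longrightarrow> y \<in> golden_ring \<Longrightarrow> x + y \<in> golden_ring"
  unfolding golden_ring_def by (clarsimp, metis (no_types) distrib_right of_int_add add.assoc add.left_commute)

lemma golden_ring_uminus: "x \<in> golden_ring \<Longrightarrow> - x \<in> golden_ring"
  unfolding golden_ring_def by (clarsimp, metis minus_add_distrib minus_mult_left of_int_minus uminus_add_conv_diff add.commute)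

lemma golden_ring_diff: "x \<in> golden_ring \<Longrightarrow> y \<in> golden_ring \<Longrightarrow> x - y \<in> golden_ring"
  using golden_ring_add[OF _ golden_ring_uminus] by fastforce

lemma golden_ring_golden_mult: "x \<in> golden_ring \<Longrightarrow> \<phi> * x \<in> golden_ring"
proof -
  assume "x \<in> golden_ring"
  then obtain a b :: int where "x = a + b * \<phi>" by (auto simp: golden_ring_def)
  then have "\<phi> * x = of_int b + of_int (a + b) * \<phi>"
    by (simp add: algebra_simps golden_square_left)
  then show ?thesis unfolding golden_ring_def by blast
qed

lemma golden_ring_numerals [simp, intro]: "0 \<in> golden_ring" "1 \<in> golden_ring" "\<phi> \<in> golden_ring"
  using golden_ring_of_int[of 0] golden_ring_of_int[of 1] golden_ring_golden_mult[of 1] by simp_all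

lemma golden_ring_golden_mult_iff [simp]: "\<phi> * x \<in> golden_ring \<longleftrightarrow> x \<in> golden_ring"
proof
  assume "\<phi> * x \<in> golden_ring"
  then have "\<phi> * (\<phi> * x) - \<phi> * x \<in> golden_ring"
    using golden_ring_golden_mult golden_ring_diff by blast
  then show "x \<in> golden_ring" by (simp add: golden_square_left)
qed (rule golden_ring_golden_mult)

lemma golden_ring_add_iff [simp]:
  "k \<in> golden_ring \<Longrightarrow> x + k \<in> golden_ring \<longleftrightarrow> x \<in> golden_ring"
  "k \<in> golden_ring \<Longrightarrow> k - x \<in> golden_ring \<longleftrightarrow> x \<in> golden_ring"
proof -
  assume k: "k \<in> golden_ring"
  show "x + k \<in> golden_ring \<longleftrightarrow> x \<in> golden_ring"
    using golden_ring_add[of x k] golden_ring_diff[of "x + k" k] k by auto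
  show "k - x \<in> golden_ring \<longleftrightarrow> x \<in> golden_ring"
    using golden_ring_diff[of k x] golden_ring_diff[of k "k - x"] k by auto
qed

lemma golden_ring_angle [simp, intro]: "of_int n / \<phi>^2 \<in> golden_ring"
proof -
  have "of_int n / \<phi>^2 = of_int (2 * n) - \<phi> * of_int n"
    by (simp add: divide_golden_power2 algebra_simps)
  also have "\<dots> \<in> golden_ring"
    by (intro golden_ring_diff golden_ring_golden_mult golden_ring_of_int)
  finally show ?thesis .
qed

lemma countable_golden_ring: "countable golden_ring"
proof -
  have "golden_ring = range (\<lambda>(a :: int, b :: int). of_int a + of_int b * \<phi>)"
    by (auto simp: golden_ring_def)
  then show ?thesis by (metis countableI_type countable_image)
qed

text \<open>Avoiding the values in \<open>\<int>[\<phi>]\<close> altogether, rather than just those on the boundary lines, makes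
  the condition invariant under the rotations and under the contraction.\<close>
definition generic :: "real \<Rightarrow> real \<Rightarrow> bool" where
  "generic x y \<longleftrightarrow> x \<notin> golden_ring \<and> y \<notin> golden_ring \<and>
     x + y \<notin> golden_ring \<and> \<phi> * x + y \<notin> golden_ring"

text \<open>Choosing \<open>x\<close> first leaves countably many values of \<open>y\<close> to be avoided.\<close>
lemma generic_exists:
  assumes "open U" "U \<noteq> {}"
  obtains x y where "(x, y) \<in> U" "generic x y"
proof -
  obtain p where "p \<in> U" using assms(2) by blast
  then obtain A B where AB: "open A" "open B" "A \<noteq> {}" "B \<noteq> {}" "A \<times> B \<subseteq> U"
    using open_prod_elim[OF assms(1)] by (metis SigmaE empty_iff)
  obtain x where x: "x \<in> A" "x \<notin> golden_ring"
    using open_minus_countable[OF countable_golden_ring AB(3,1)] by blast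
  let ?C = "golden_ring \<union> (\<lambda>c. c - x) ` golden_ring \<union> (\<lambda>c. c - \<phi> * x) ` golden_ring"
  have "countable ?C" using countable_golden_ring by blast
  then obtain y where y: "y \<in> B" "y \<notin> ?C"
    using open_minus_countable[OF _ AB(4,2)] by blast
  have "z + y \<notin> golden_ring" if "y \<notin> (\<lambda>c. c - z) ` golden_ring" for z
    using that by (metis add_diff_cancel_left' image_eqI)
  with x y have "generic x y" by (auto simp: generic_def)
  with x y AB(5) that show ?thesis by blast
qed

lemma generic_translate [simp]:
  assumes "k \<in> golden_ring" "l \<in> golden_ring"
  shows "generic (x + k) (y + l) \<longleftrightarrow> generic x y"
proof -
  have "x + k + (y + l) = x + y + (k + l)" "\<phi> * (x + k) + (y + l) = \<phi> * x + y + (\<phi> * k + l)"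
    by (simp_all add: algebra_simps)
  then show ?thesis using assms unfolding generic_def
    by (metis golden_ring_add golden_ring_add_iff(1) golden_ring_golden_mult)
qed

lemma generic_frac [simp]: "generic (frac x) (frac y) \<longleftrightarrow> generic x y"
  using generic_translate[OF golden_ring_of_int[of "- \<lfloor>x\<rfloor>"] golden_ring_of_int[of "- \<lfloor>y\<rfloor>"], of x y]
  by (simp add: frac_def)

lemma generic_expand [simp]: "generic (1 - \<phi> * x) (1 - \<phi> * y) \<longleftrightarrow> generic x y"
proof -
  have e: "1 - \<phi> * x + (1 - \<phi> * y) = of_int 2 - \<phi> * (x + y)"
    "\<phi> * (1 - \<phi> * x) + (1 - \<phi> * y) = (\<phi> + 1) - \<phi> * (\<phi> * x + y)"
    by (simp_all add: algebra_simps)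
  have "\<phi> + 1 \<in> golden_ring" by (intro golden_ring_add golden_ring_numerals)
  then show ?thesis unfolding generic_def e
    by (simp only: golden_ring_add_iff golden_ring_of_int golden_ring_numerals golden_ring_golden_mult_iff)
qed

lemma generic_contract [simp]: "generic ((1 - x) / \<phi>) ((1 - y) / \<phi>) \<longleftrightarrow> generic x y"
  using generic_expand[of "(1 - x) / \<phi>" "(1 - y) / \<phi>"] golden_bounds by simp

definition coding :: "real \<Rightarrow> real \<Rightarrow> nat config" where
  "coding x y = (\<lambda>(i, j). letter (frac (x + i / \<phi>^2)) (frac (y + j / \<phi>^2)))"

lemma letter_le: "letter x y \<le> 15"
  by (simp add: letter_def letter_of_def)

lemma coding_le: "coding x y k \<le> 15"
  by (simp add: coding_def letter_le split: prod.splits)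

definition atom :: "nat \<Rightarrow> (real \<times> real) set" where
  "atom a = interior (convex hull (set (polygon_vertices ! a)))"

lemma atom_in_strips: "a \<le> 15 \<Longrightarrow> (x, y) \<in> atom a \<Longrightarrow> in_strips a x y (x + y) (\<phi> * x + y)"
  unfolding atom_def by (rule interior_polygon_in_strips)

lemma letter_eq_of_atom: "a \<le> 15 \<Longrightarrow> (x, y) \<in> atom a \<Longrightarrow> letter x y = a"
  unfolding letter_def by (intro letter_of_in_strips atom_in_strips)

lemma in_strips_unit_square:
  assumes "a \<le> 15" "in_strips a x y s t"
  shows "0 < x \<and> x < 1 \<and> 0 < y \<and> y < 1"
proof -
  have "\<forall>a\<le>15. in_strips a x y s t \<longrightarrow> 0 < x \<and> x < 1 \<and> 0 < y \<and> y < 1"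
    unfolding all_letters using golden_bounds
    by (intro conjI impI; simp add: in_strips_def strip_bounds_def)
  with assms show ?thesis by blast
qed

lemma frac_positive: "x \<notin> golden_ring \<Longrightarrow> 0 < frac x"
  using frac_gt_0_iff[of x] by (auto simp: Ints_def)

lemma generic_in_atom:
  assumes "generic x y"
  shows "(frac x, frac y) \<in> atom (letter (frac x) (frac y))"
  unfolding atom_def
proof (rule letter_interior_polygon)
  have g: "generic (frac x) (frac y)" using assms by simp
  show "0 < frac x" "0 < frac y" using assms frac_positive by (auto simp only: generic_def)
  show "frac x < 1" "frac y < 1" by (simp_all add: frac_lt_1)
  have "\<phi> - 1 \<in> golden_ring" "of_int 2 - \<phi> \<in> golden_ring" "of_int 3 - \<phi> \<in> golden_ring"
    by (intro golden_ring_diff golden_ring_of_int golden_ring_numerals)+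
  with g show "frac x \<noteq> \<phi> - 1" "frac y \<noteq> \<phi> - 1" "frac x + frac y \<notin> {2 - \<phi>, 1, 3 - \<phi>}"
    "\<phi> * frac x + frac y \<notin> {\<phi> - 1, 1, \<phi>}"
    unfolding generic_def by auto
qed

text \<open>The atoms lie in the open unit square, so a representative in an atom is the standard one.\<close>
lemma frac_eq_if_mem_atom:
  assumes "a \<le> 15" "(x - of_int m, y - of_int n) \<in> atom a"
  shows "frac x = x - of_int m" "frac y = y - of_int n"
proof -
  have "0 < x - of_int m" "x - of_int m < 1" "0 < y - of_int n" "y - of_int n < 1"
    using in_strips_unit_square[OF assms(1) atom_in_strips[OF assms]] by auto
  then have "\<lfloor>x\<rfloor> = m" "\<lfloor>y\<rfloor> = n" by (simp_all add: floor_eq_iff)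
  then show "frac x = x - of_int m" "frac y = y - of_int n" by (simp_all add: frac_def)
qed

lemma rotation_mem_partition:
  assumes "a \<le> 15"
  shows "rotation_Z (i, j) (to_torus (x, y)) \<in> partition_Z a \<longleftrightarrow>
    (frac (x + i / \<phi>^2), frac (y + j / \<phi>^2)) \<in> atom a"
proof -
  define u v where "u = x + i / \<phi>^2" and "v = y + j / \<phi>^2"
  have "rotation_Z (i, j) (to_torus (x, y)) = to_torus (u, v)"
    by (simp add: rotation_Z.abs_eq u_def v_def)
  moreover have "to_torus (u, v) \<in> partition_Z a \<longleftrightarrow> (frac u, frac v) \<in> atom a"
  proof
    assume "to_torus (u, v) \<in> partition_Z a"
    then obtain u' v' where *: "(u', v') \<in> atom a" "u - u' \<in> \<int>" "v - v' \<in> \<int>"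
      by (auto simp: partition_Z_def atom_def torus.abs_eq_iff)
    obtain m n where mn: "u - u' = of_int m" "v - v' = of_int n" using *(2,3) by (auto elim!: Ints_cases)
    then have "u' = u - of_int m" "v' = v - of_int n" by simp_all
    with *(1) frac_eq_if_mem_atom[OF assms, of u m v n] show "(frac u, frac v) \<in> atom a" by simp
  next
    assume "(frac u, frac v) \<in> atom a"
    moreover have "to_torus (u, v) = to_torus (frac u, frac v)"
      by (simp add: torus.abs_eq_iff frac_def)
    ultimately show "to_torus (u, v) \<in> partition_Z a"
      unfolding partition_Z_def atom_def by auto
  qed
  ultimately show ?thesis by (simp add: u_def v_def)
qed

lemma open_frac_atom:
  assumes "a \<le> 15"
  shows "open {(x, y). (frac (x + c), frac (y + d)) \<in> atom a}"
proof -
  have "{(x, y). (frac (x + c), frac (y + d)) \<in> atom a} =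
      (\<Union>m n. (\<lambda>p. (fst p + c - of_int m, snd p + d - of_int n)) -` atom a)" (is "?L = ?R")
  proof
    show "?L \<subseteq> ?R"
      by (force simp: frac_def)
    show "?R \<subseteq> ?L" using frac_eq_if_mem_atom[OF assms] by fastforce
  qed
  moreover have "open (atom a)" by (simp add: atom_def)
  ultimately show ?thesis
    by (auto intro!: open_UN open_vimage continuous_intros)
qed

text \<open>The points realizing a finite pattern form an open set, so if there is one there is a generic
  one; and at a generic point the decision tree and the atoms give the same letter.\<close>
lemma allowed_iff_generic:
  assumes "finite S" "\<And>k. w k \<le> 15"
  shows "allowed partition_Z rotation_Z S (restrict w S) \<longleftrightarrow>
    (\<exists>x y. generic x y \<and> (\<forall>k\<in>S. coding x y k = w k))"
proof
  define U where "U k = {(x, y). (frac (x + fst k / \<phi>^2), frac (y + snd k / \<phi>^2)) \<in> atom (w k)}"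
    for k :: "int \<times> int"
  have mem: "rotation_Z k (to_torus p) \<in> partition_Z (w k) \<longleftrightarrow> p \<in> U k" for k p
    using rotation_mem_partition[OF assms(2), of "fst k" "snd k" "fst p" "snd p" k]
    by (simp add: U_def case_prod_unfold)
  {
    assume "allowed partition_Z rotation_Z S (restrict w S)"
    then obtain q where "\<forall>k\<in>S. rotation_Z k q \<in> partition_Z (w k)"
      by (auto simp: allowed_def)
    then have "\<forall>k\<in>S. rep_torus q \<in> U k"
      unfolding mem[symmetric] using Quotient3_abs_rep[OF Quotient3_torus] by simp
    moreover have "open (\<Inter>k\<in>S. U k)"
      using assms open_frac_atom unfolding U_def by (intro open_INT) auto
    ultimately obtain x y where xy: "(x, y) \<in> (\<Inter>k\<in>S. U k)" "generic x y"
      using generic_exists[of "\<Inter>k\<in>S. U k"] by blast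
    have "coding x y k = w k" if "k \<in> S" for k
      using xy(1) that letter_eq_of_atom[OF assms(2)] by (auto simp: U_def coding_def case_prod_unfold)
    with xy(2) show "\<exists>x y. generic x y \<and> (\<forall>k\<in>S. coding x y k = w k)" by blast
  next
    assume "\<exists>x y. generic x y \<and> (\<forall>k\<in>S. coding x y k = w k)"
    then obtain x y where xy: "generic x y" "\<forall>k\<in>S. coding x y k = w k" by blast
    have "(x, y) \<in> U k" if "k \<in> S" for k
    proof -
      have "generic (x + fst k / \<phi>^2) (y + snd k / \<phi>^2)" using xy(1) by simp
      from generic_in_atom[OF this] show ?thesis
        using xy(2) that by (force simp: U_def coding_def case_prod_unfold)
    qed
    then show "allowed partition_Z rotation_Z S (restrict w S)"
      unfolding allowed_def mem[symmetric] by fastforce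
  }
qed

lemma coding_add:
  fixes k n :: "int \<times> int"
  shows "coding x y (k + n) = coding (x + fst n / \<phi>^2) (y + snd n / \<phi>^2) k"
  by (simp add: coding_def case_prod_unfold add_divide_distrib algebra_simps)

lemma X_Z_iff:
  "x \<in> X_Z \<longleftrightarrow> (\<forall>S. finite S \<longrightarrow> (\<exists>u v. generic u v \<and> (\<forall>k\<in>S. coding u v k = x k)))"
  (is "_ \<longleftrightarrow> ?R")
proof
  assume *: "x \<in> X_Z"
  then have "x k \<le> 15" for k by (cases k) (auto simp: X_Z_def symbolic_system_def)
  moreover have "allowed partition_Z rotation_Z S (restrict x S)" if "finite S" for S
  proof -
    have "shift (0, 0) x = x" by (simp add: shift_def flip: zero_prod_def)
    moreover have "allowed partition_Z rotation_Z S (restrict (shift (0, 0) x) S)"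
      using * that unfolding X_Z_def symbolic_system_def by blast
    ultimately show ?thesis by simp
  qed
  ultimately show ?R using allowed_iff_generic by blast
next
  assume R: ?R
  have le: "x k \<le> 15" for k
  proof -
    obtain u v where "coding u v k = x k" using R by (metis finite.simps insertI1)
    then show ?thesis using coding_le by metis
  qed
  have "allowed partition_Z rotation_Z S (restrict (shift n x) S)" if "finite S" for n S
  proof -
    have "finite ((\<lambda>k. k + n) ` S)" using that by simp
    with R obtain u v where uv: "generic u v" "\<forall>k\<in>(\<lambda>k. k + n) ` S. coding u v k = x k" by blast
    have "generic (u + fst n / \<phi>^2) (v + snd n / \<phi>^2)"
      "\<forall>k\<in>S. coding (u + fst n / \<phi>^2) (v + snd n / \<phi>^2) k = shift n x k"
      using uv by (simp_all add: shift_def coding_add)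
    moreover have "shift n x k \<le> 15" for k by (simp add: shift_def le)
    ultimately show ?thesis using allowed_iff_generic[OF that] by blast
  qed
  with le show "x \<in> X_Z" by (auto simp: X_Z_def symbolic_system_def)
qed

section \<open>The image of a coding\<close>

text \<open>The number of columns (rows) in the image of a letter at a point with this abscissa (ordinate),
  which is the return time of the contracted coordinate to \<open>[0, 1/\<phi>)\<close>.\<close>
definition code_width :: "real \<Rightarrow> nat" where
  "code_width u = (if frac u < \<phi> - 1 then 2 else 1)"

definition contract :: "real \<Rightarrow> real" where
  "contract u = (1 - frac u) / \<phi>"

lemma Phi_letter_size:
  "width (\<Phi> (letter x y)) = (if x < \<phi> - 1 then 2 else 1)"
  "height (\<Phi> (letter x y)) = (if y < \<phi> - 1 then 2 else 1)"
  by (simp_all add: Phi_size letter_def letter_of_def Phi_matrices_def)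

lemma Phi_coding_size:
  "width (\<Phi> (coding u v (i, j))) = code_width (u + i / \<phi>^2)"
  "height (\<Phi> (coding u v (i, j))) = code_width (v + j / \<phi>^2)"
  by (simp_all add: coding_def Phi_letter_size code_width_def)

lemma one_minus_golden_contract: "1 - \<phi> * contract u = frac u"
  using golden_bounds by (simp add: contract_def)

text \<open>Moving \<open>u\<close> by one step of the rotation moves \<open>contract u\<close> to its next visit to \<open>[0, 1/\<phi>)\<close>.
  The exact difference is 1 for return time 2, since \<open>2/\<phi>\<^sup>2 + 1/\<phi>\<^sup>3 = 1\<close>, and 0 for return time 1.\<close>
lemma contract_step: "contract u + code_width u / \<phi>^2 - contract (u + 1 / \<phi>^2) \<in> \<int>"
proof -
  have c: "contract z = (1 - frac z) * (\<phi> - 1)" for z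
    using inverse_golden by (simp add: contract_def divide_inverse)
  have angle: "1 / \<phi>^2 = 2 - \<phi>" by (simp add: divide_golden_power2)
  have "frac (2 - \<phi>) = 2 - \<phi>" using golden_bounds by (simp add: frac_eq)
  then have f: "frac (u + (2 - \<phi>)) = (if frac u < \<phi> - 1 then frac u + (2 - \<phi>) else frac u + (1 - \<phi>))"
    by (auto simp: frac_add)
  have "contract u + code_width u / \<phi>^2 - contract (u + 1 / \<phi>^2) =
      (if frac u < \<phi> - 1 then 1 else 0)"
    unfolding c angle f
    by (simp add: code_width_def divide_golden_power2 algebra_simps golden_square)
  then show ?thesis by simp
qed

lemma pos_add_one: "pos d (i + 1) = pos d i + int (d i)"
proof (cases "0 \<le> i")
  case True
  then have "{0..<i + 1} = insert i {0..<i}" by auto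
  with True show ?thesis by (simp add: pos_def)
next
  case False
  then have "{i..<0} = insert i {i + 1..<0}" by auto
  with False show ?thesis by (cases "i = -1") (auto simp: pos_def)
qed

lemma contract_orbit:
  defines "d \<equiv> \<lambda>u i. code_width (u + of_int i / \<phi>^2)"
  shows "contract u + pos (d u) i / \<phi>^2 - contract (u + i / \<phi>^2) \<in> \<int>"
proof -
  define g where "g i = contract u + pos (d u) i / \<phi>^2 - contract (u + i / \<phi>^2)" for i :: int
  have "g (i + 1) - g i \<in> \<int>" for i
  proof -
    have "g (i + 1) - g i = contract (u + i / \<phi>^2) + code_width (u + i / \<phi>^2) / \<phi>^2
        - contract (u + i / \<phi>^2 + 1 / \<phi>^2)"
      by (simp add: g_def pos_add_one d_def add_divide_distrib add.assoc)
    with contract_step show ?thesis by metis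
  qed
  then have iff: "g (i + 1) \<in> \<int> \<longleftrightarrow> g i \<in> \<int>" for i
    by (metis Ints_add Ints_diff diff_add_cancel minus_diff_eq diff_diff_eq2 add_diff_cancel_left')
  have "g i \<in> \<int>"
  proof (induction i rule: int_induct[of _ 0])
    case base
    then show ?case by (simp add: g_def pos_def)
  next
    case (step1 i)
    then show ?case using iff by blast
  next
    case (step2 i)
    then show ?case using iff[of "i - 1"] by simp
  qed
  then show ?thesis by (simp add: g_def)
qed

text \<open>Within a block there is no reduction modulo 1, as \<open>1/\<phi> + 1/\<phi>\<^sup>2 = 1\<close>.\<close>
lemma frac_contract_orbit:
  defines "d \<equiv> \<lambda>u i. code_width (u + of_int i / \<phi>^2)"
  assumes "u \<notin> golden_ring" "k < d u i"
  shows "frac (contract u + (pos (d u) i + int k) / \<phi>^2) = contract (u + i / \<phi>^2) + k / \<phi>^2"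
proof -
  define z where "z = u + i / \<phi>^2"
  have "z \<notin> golden_ring" using assms(2) by (simp add: z_def)
  then have z: "0 < frac z" "frac z < 1" by (simp_all add: frac_positive frac_lt_1 del: frac_gt_0_iff)
  have c: "contract z = \<phi> - 1 - (\<phi> - 1) * frac z"
    unfolding contract_def divide_inverse inverse_golden[unfolded divide_inverse mult_1]
    by (simp add: algebra_simps)
  have "0 < (\<phi> - 1) * frac z" "(\<phi> - 1) * frac z < \<phi> - 1" using z golden_bounds by simp_all
  then have "0 < contract z" "contract z < \<phi> - 1" using c by simp_all
  moreover have "k = 0 \<or> k = 1" using assms(3) by (auto simp: d_def code_width_def split: if_splits)
  ultimately have "0 \<le> contract z + k / \<phi>^2" "contract z + k / \<phi>^2 < 1"
    using golden_bounds by (auto simp: divide_golden_power2)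
  moreover have "contract u + (pos (d u) i + int k) / \<phi>^2 - (contract z + k / \<phi>^2) \<in> \<int>"
    using contract_orbit[of u i] by (simp add: z_def d_def add_divide_distrib algebra_simps)
  ultimately show ?thesis unfolding frac_unique_iff z_def by simp
qed

lemma pos_le:
  assumes "\<And>k. 1 \<le> d k"
  shows "0 \<le> i \<Longrightarrow> i \<le> pos d i" "i \<le> 0 \<Longrightarrow> pos d i \<le> i"
proof -
  have d: "1 \<le> int (d k)" for k using assms[of k] by simp
  show "0 \<le> i \<Longrightarrow> i \<le> pos d i"
  proof (induction i rule: int_ge_induct)
    case (step i)
    then show ?case using pos_add_one[of d i] d[of i] by simp
  qed (simp add: pos_def)
  show "i \<le> 0 \<Longrightarrow> pos d i \<le> i"
  proof (induction i rule: int_le_induct)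
    case (step i)
    then show ?case using pos_add_one[of d "i - 1"] d[of "i - 1"] by simp
  qed (simp add: pos_def)
qed

text \<open>Existence of the index chosen by \<open>locate\<close>.  The bound on it, due to all blocks being
  nonempty, makes the image of a configuration local.\<close>
lemma block_containing:
  assumes "\<And>k. 1 \<le> d k"
  obtains i where "pos d i \<le> p" "p < pos d (i + 1)" "\<bar>i\<bar> \<le> \<bar>p\<bar>"
proof -
  have d: "1 \<le> int (d k)" for k using assms[of k] by simp
  have "\<exists>i. pos d i \<le> p \<and> p < pos d (i + 1)"
  proof (induction p rule: int_induct[of _ 0])
    case base
    then show ?case using pos_add_one[of d 0] d[of 0] by (intro exI[of _ 0]) (simp add: pos_def)
  next
    case (step1 p)
    then obtain i where i: "pos d i \<le> p" "p < pos d (i + 1)" by blast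
    show ?case
    proof (cases "p + 1 < pos d (i + 1)")
      case False
      then show ?thesis using i pos_add_one[of d "i + 1"] d[of "i + 1"] by (intro exI[of _ "i + 1"]) simp
    qed (use i in force)
  next
    case (step2 p)
    then obtain i where i: "pos d i \<le> p" "p < pos d (i + 1)" by blast
    show ?case
    proof (cases "pos d i \<le> p - 1")
      case False
      then show ?thesis using i pos_add_one[of d "i - 1"] d[of "i - 1"] by (intro exI[of _ "i - 1"]) simp
    qed (use i in force)
  qed
  then obtain i where i: "pos d i \<le> p" "p < pos d (i + 1)" by blast
  have "\<bar>i\<bar> \<le> \<bar>p\<bar>"
    using i pos_le[of d i] pos_le[of d "i + 1"] assms by (cases "0 \<le> i") force+
  with i that show ?thesis by blast
qed

text \<open>The renormalization: the blocks of the image are the parts of the orbit of the contracted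
  point between successive visits to \<open>[0, 1/\<phi>)\<^sup>2\<close>.\<close>
lemma config_image_coding:
  assumes "generic u v"
  shows "config_image \<Phi> (coding u v) = coding (contract u) (contract v)"
proof (intro ext, clarify)
  fix p q
  let ?d = "\<lambda>u i. code_width (u + of_int i / \<phi>^2)"
  have cw: "col_width \<Phi> (coding u v) = ?d u" and rh: "row_height \<Phi> (coding u v) = ?d v"
    by (auto simp: col_width_def row_height_def Phi_coding_size)
  have ge: "1 \<le> ?d u i" for u i by (simp add: code_width_def)
  obtain i where i: "pos (?d u) i \<le> p" "p < pos (?d u) (i + 1)"
    using block_containing[of "?d u" p] ge by metis
  obtain j where j: "pos (?d v) j \<le> q" "q < pos (?d v) (j + 1)"
    using block_containing[of "?d v" q] ge by metis
  define k l where "k = nat (p - pos (?d u) i)" and "l = nat (q - pos (?d v) j)"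
  have p: "p = pos (?d u) i + int k" and q: "q = pos (?d v) j + int l"
    using i j by (simp_all add: k_def l_def)
  have kl: "k < ?d u i" "l < ?d v j" using i j unfolding p q pos_add_one by simp_all
  let ?z = "u + i / \<phi>^2" and ?w = "v + j / \<phi>^2"
  have "generic ?z ?w" using assms by simp
  then have "(frac ?z, frac ?w) \<in> atom (letter (frac ?z) (frac ?w))" by (rule generic_in_atom)
  from atom_in_strips[OF letter_le this]
  have "letter (contract ?z + k / \<phi>^2) (contract ?w + l / \<phi>^2) =
      letters (\<Phi> (letter (frac ?z) (frac ?w))) (k, l)"
    using kl letter_le letter_Phi[of "contract ?z" "contract ?w" k l]
    unfolding one_minus_golden_contract by (auto simp: Phi_letter_size code_width_def)
  moreover have "u \<notin> golden_ring" "v \<notin> golden_ring" using assms by (simp_all add: generic_def)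
  ultimately have "coding (contract u) (contract v) (p, q) =
      letters (\<Phi> (letter (frac ?z) (frac ?w))) (k, l)"
    using frac_contract_orbit[of u k i] frac_contract_orbit[of v l j] kl
    by (simp add: coding_def p q)
  moreover have "config_image \<Phi> (coding u v) (p, q) = letters (\<Phi> (coding u v (i, j))) (k, l)"
    using config_image_eq[of \<Phi> "coding u v" i p j q] i j by (simp add: cw rh k_def l_def)
  ultimately show "config_image \<Phi> (coding u v) (p, q) = coding (contract u) (contract v) (p, q)"
    by (simp add: coding_def)
qed

lemma generic_contract_frac: "generic u v \<Longrightarrow> generic (contract u) (contract v)"
  unfolding contract_def by simp

lemma coding_cong:
  assumes "x - x' \<in> \<int>" "y - y' \<in> \<int>"
  shows "coding x y = coding x' y'"
proof -
  have "frac (z + c) = frac (z' + c)" if "z - z' \<in> \<int>" for z z' c :: real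
  proof -
    have "z + c - frac (z' + c) = (z - z') + of_int \<lfloor>z' + c\<rfloor>" by (simp add: frac_def)
    also have "\<dots> \<in> \<int>" using that by simp
    finally show ?thesis unfolding frac_unique_iff by (simp add: frac_lt_1)
  qed
  then show ?thesis using assms by (simp add: coding_def)
qed

text \<open>The contracted points fill \<open>(0, 1/\<phi>)\<close>.  A point of \<open>(1/\<phi>, 1)\<close> enters this interval by one
  step backwards.\<close>
lemma contract_preimage:
  assumes "u \<notin> golden_ring"
  obtains s :: int where "s \<in> {0, 1}"
    "u - s / \<phi>^2 - contract (1 - \<phi> * frac (u - s / \<phi>^2)) \<in> \<int>"
proof -
  define s :: int where "s = (if frac u < \<phi> - 1 then 0 else 1)"
  define z where "z = u - s / \<phi>^2"
  have "z + s / \<phi>^2 \<notin> golden_ring" using assms by (simp add: z_def)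
  then have "z \<notin> golden_ring" by simp
  then have z0: "0 < frac z" by (rule frac_positive)
  have ne: "frac u \<noteq> \<phi> - 1"
  proof
    assume "frac u = \<phi> - 1"
    then have "u = (\<phi> - of_int 1) + of_int \<lfloor>u\<rfloor>" by (simp add: frac_def)
    also have "\<dots> \<in> golden_ring"
      by (intro golden_ring_add golden_ring_diff golden_ring_of_int golden_ring_numerals)
    finally show False using assms by simp
  qed
  have "frac z < \<phi> - 1"
  proof (cases "s = 0")
    case True
    then show ?thesis by (simp add: z_def s_def split: if_splits)
  next
    case False
    then have "frac (u - (2 - \<phi>)) = frac u - (2 - \<phi>)"
      using golden_bounds frac_lt_1[of u] unfolding frac_unique_iff
      by (auto simp: s_def frac_def split: if_splits)
    then show ?thesis using False frac_lt_1[of u] ne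
      by (auto simp: z_def s_def divide_golden_power2 split: if_splits)
  qed
  then have "\<phi> * frac z < \<phi> * (\<phi> - 1)" "0 < \<phi> * frac z" using z0 golden_bounds by simp_all
  then have "frac (1 - \<phi> * frac z) = 1 - \<phi> * frac z"
    by (auto simp: frac_eq algebra_simps golden_square)
  then have "contract (1 - \<phi> * frac z) = frac z"
    using golden_bounds by (simp add: contract_def)
  then have "z - contract (1 - \<phi> * frac z) \<in> \<int>" by (simp add: frac_def)
  then show ?thesis using that[of s] by (simp add: z_def s_def)
qed

lemma coding_desubstitution:
  assumes "generic u v"
  obtains s u' v' where "s \<in> {0, 1} \<times> {0, 1}" "generic u' v'"
    "coding u v = shift s (config_image \<Phi> (coding u' v'))"
proof -
  have uv: "u \<notin> golden_ring" "v \<notin> golden_ring" using assms by (simp_all add: generic_def)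
  obtain s1 :: int where s1: "s1 \<in> {0, 1}"
    "u - s1 / \<phi>^2 - contract (1 - \<phi> * frac (u - s1 / \<phi>^2)) \<in> \<int>"
    using contract_preimage[OF uv(1)] by blast
  obtain s2 :: int where s2: "s2 \<in> {0, 1}"
    "v - s2 / \<phi>^2 - contract (1 - \<phi> * frac (v - s2 / \<phi>^2)) \<in> \<int>"
    using contract_preimage[OF uv(2)] by blast
  define u' v' where "u' = 1 - \<phi> * frac (u - s1 / \<phi>^2)" and "v' = 1 - \<phi> * frac (v - s2 / \<phi>^2)"
  have "generic (u - s1 / \<phi>^2 + s1 / \<phi>^2) (v - s2 / \<phi>^2 + s2 / \<phi>^2)" using assms by simp
  then have "generic (u - s1 / \<phi>^2) (v - s2 / \<phi>^2)"
    by (simp only: generic_translate golden_ring_angle)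
  then have g: "generic u' v'" unfolding u'_def v'_def by simp
  have "coding u v = shift (s1, s2) (coding (u - s1 / \<phi>^2) (v - s2 / \<phi>^2))"
    by (simp add: shift_def coding_add)
  also have "coding (u - s1 / \<phi>^2) (v - s2 / \<phi>^2) = coding (contract u') (contract v')"
    using s1(2) s2(2) unfolding u'_def v'_def by (rule coding_cong)
  also have "\<dots> = config_image \<Phi> (coding u' v')" using config_image_coding[OF g] by simp
  finally show ?thesis using that[of "(s1, s2)"] s1(1) s2(1) g by blast
qed

section \<open>The substitution maps the system to itself\<close>

text \<open>The central squares exhaust the plane, so they can replace arbitrary finite domains.\<close>
definition square :: "int \<Rightarrow> (int \<times> int) set" where
  "square N = {-N..N} \<times> {-N..N}"

lemma finite_square: "finite (square N)"
  by (simp add: square_def)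

lemma finite_subset_square:
  assumes "finite S"
  obtains N where "0 \<le> N" "S \<subseteq> square N"
proof -
  define N where "N = (\<Sum>k\<in>S. \<bar>fst k\<bar> + \<bar>snd k\<bar>)"
  have "\<bar>fst k\<bar> + \<bar>snd k\<bar> \<le> N" if "k \<in> S" for k
    unfolding N_def using assms that by (intro member_le_sum) auto
  then have "S \<subseteq> square N" by (force simp: square_def)
  moreover have "0 \<le> N" unfolding N_def by (intro sum_nonneg) auto
  ultimately show ?thesis using that by blast
qed

lemma config_image_local:
  assumes width: "\<And>k. 1 \<le> width (\<omega> (x k))" and height: "\<And>k. 1 \<le> height (\<omega> (x k))"
    and agree: "\<And>k. k \<in> square (N + 1) \<Longrightarrow> x k = x' k" and k: "k \<in> square N"
  shows "config_image \<omega> x k = config_image \<omega> x' k"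
proof -
  obtain p q where pq: "k = (p, q)" "\<bar>p\<bar> \<le> N" "\<bar>q\<bar> \<le> N" using k by (force simp: square_def)
  have pos_eq: "pos d i = pos d' i" if "\<And>k. \<bar>k\<bar> \<le> N + 1 \<Longrightarrow> d k = d' k" "\<bar>i\<bar> \<le> N + 1" for d d' i
    using that by (auto simp: pos_def intro!: sum.cong)
  have axes: "x (i, 0) = x' (i, 0)" "x (0, i) = x' (0, i)" if "\<bar>i\<bar> \<le> N + 1" for i
    using that pq(2) by (auto intro!: agree simp: square_def)
  have c: "pos (col_width \<omega> x) i = pos (col_width \<omega> x') i" if "\<bar>i\<bar> \<le> N + 1" for i
    using that axes by (intro pos_eq) (auto simp: col_width_def)
  have r: "pos (row_height \<omega> x) i = pos (row_height \<omega> x') i" if "\<bar>i\<bar> \<le> N + 1" for i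
    using that axes by (intro pos_eq) (auto simp: row_height_def)
  obtain i where i: "pos (col_width \<omega> x) i \<le> p" "p < pos (col_width \<omega> x) (i + 1)" "\<bar>i\<bar> \<le> \<bar>p\<bar>"
    using block_containing[of "col_width \<omega> x" p] width by (metis col_width_def)
  obtain j where j: "pos (row_height \<omega> x) j \<le> q" "q < pos (row_height \<omega> x) (j + 1)" "\<bar>j\<bar> \<le> \<bar>q\<bar>"
    using block_containing[of "row_height \<omega> x" q] height by (metis row_height_def)
  have "config_image \<omega> x (p, q) = letters (\<omega> (x (i, j)))
      (p - pos (col_width \<omega> x) i, q - pos (row_height \<omega> x) j)"
    by (rule config_image_eq) (use i j in auto)
  moreover have "config_image \<omega> x' (p, q) = letters (\<omega> (x' (i, j)))
      (p - pos (col_width \<omega> x') i, q - pos (row_height \<omega> x') j)"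
    by (rule config_image_eq) (use i j pq c[of i] c[of "i + 1"] r[of j] r[of "j + 1"] in auto)
  moreover have "x (i, j) = x' (i, j)" by (rule agree) (use i j pq in \<open>auto simp: square_def\<close>)
  ultimately show ?thesis using i j pq c[of i] r[of j] by simp
qed

lemma Phi_size_pos:
  assumes "a \<le> 15"
  shows "1 \<le> width (\<Phi> a)" "1 \<le> height (\<Phi> a)"
proof -
  have "\<forall>a\<le>15. 1 \<le> width (\<Phi> a) \<and> 1 \<le> height (\<Phi> a)"
    unfolding all_letters by (simp add: Phi_size Phi_matrices_def)
  then show "1 \<le> width (\<Phi> a)" "1 \<le> height (\<Phi> a)" using assms by blast+
qed

lemma X_Z_le: "x \<in> X_Z \<Longrightarrow> x k \<le> 15"
  by (cases k) (auto simp: X_Z_def symbolic_system_def)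

lemma coding_in_X_Z: "generic u v \<Longrightarrow> coding u v \<in> X_Z"
  unfolding X_Z_iff by blast

lemma X_Z_agree:
  assumes "x \<in> X_Z" "finite S"
  obtains u v where "generic u v" "\<And>k. k \<in> S \<Longrightarrow> coding u v k = x k"
  using assms unfolding X_Z_iff by blast

text \<open>This is the closedness of \<open>X_Z\<close>: the patterns of \<open>x\<close> on the squares define a neighbourhood base at \<open>x\<close>.\<close>
lemma X_Z_limit:
  assumes "\<And>N. \<exists>x'\<in>X_Z. \<forall>k\<in>square N. x' k = x k"
  shows "x \<in> X_Z"
  unfolding X_Z_iff
proof (intro allI impI)
  fix S :: "(int \<times> int) set" assume S: "finite S"
  then obtain N where "S \<subseteq> square N" using finite_subset_square by blast
  moreover obtain x' where "x' \<in> X_Z" "\<forall>k\<in>square N. x' k = x k" using assms by blast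
  moreover from this(1) S obtain u v where "generic u v" "\<And>k. k \<in> S \<Longrightarrow> coding u v k = x' k"
    using X_Z_agree by blast
  ultimately show "\<exists>u v. generic u v \<and> (\<forall>k\<in>S. coding u v k = x k)" by (metis subsetD)
qed

lemma shift_X_Z:
  assumes "x \<in> X_Z"
  shows "shift n x \<in> X_Z"
  unfolding X_Z_iff
proof (intro allI impI)
  fix S :: "(int \<times> int) set" assume "finite S"
  then have "finite ((\<lambda>k. k + n) ` S)" by simp
  then obtain u v where uv: "generic u v"
    "\<And>k. k \<in> (\<lambda>k. k + n) ` S \<Longrightarrow> coding u v k = x k" using X_Z_agree[OF assms] by blast
  then have "generic (u + fst n / \<phi>^2) (v + snd n / \<phi>^2)"
    "\<forall>k\<in>S. coding (u + fst n / \<phi>^2) (v + snd n / \<phi>^2) k = shift n x k"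
    by (simp_all add: shift_def flip: coding_add)
  then show "\<exists>u v. generic u v \<and> (\<forall>k\<in>S. coding u v k = shift n x k)" by blast
qed

text \<open>Letters in a column come from points with equal abscissa, which determines the width of their
  images; likewise for rows.\<close>
lemma matching_X_Z:
  assumes "x \<in> X_Z"
  shows "matching \<Phi> UNIV x"
proof -
  have "height (\<Phi> (x (i, j))) = height (\<Phi> (x (i + 1, j)))" for i j
    using X_Z_agree[OF assms, of "{(i, j), (i + 1, j)}"] Phi_coding_size(2)
    by (metis finite.emptyI finite.insertI insertI1 insertI2)
  moreover have "width (\<Phi> (x (i, j))) = width (\<Phi> (x (i, j + 1)))" for i j
    using X_Z_agree[OF assms, of "{(i, j), (i, j + 1)}"] Phi_coding_size(1)
    by (metis finite.emptyI finite.insertI insertI1 insertI2)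
  ultimately show ?thesis by (simp add: matching_def)
qed

lemma config_image_X_Z:
  assumes "x \<in> X_Z"
  shows "config_image \<Phi> x \<in> X_Z"
proof (rule X_Z_limit)
  fix N
  obtain u v where uv: "generic u v" "\<And>k. k \<in> square (N + 1) \<Longrightarrow> coding u v k = x k"
    using X_Z_agree[OF assms finite_square] by blast
  have "config_image \<Phi> (coding u v) k = config_image \<Phi> x k" if "k \<in> square N" for k
    by (rule config_image_local[OF _ _ uv(2) that]) (auto intro!: Phi_size_pos coding_le simp del: One_nat_def)
  moreover have "config_image \<Phi> (coding u v) \<in> X_Z"
    unfolding config_image_coding[OF uv(1)] by (intro coding_in_X_Z generic_contract_frac uv(1))
  ultimately show "\<exists>x'\<in>X_Z. \<forall>k\<in>square N. x' k = config_image \<Phi> x k" by blast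
qed

section \<open>Desubstitution by compactness\<close>

lemma configs_cluster_point:
  fixes F :: "nat \<Rightarrow> nat config"
  assumes "\<And>n k. F n k \<le> b"
  obtains x where "\<And>S m. finite S \<Longrightarrow> \<exists>n\<ge>m. \<forall>k\<in>S. F n k = x k"
proof -
  let ?C = "PiE UNIV (\<lambda>_ :: int \<times> int. {..b})"
  have "compactin (product_topology (\<lambda>_. euclidean) UNIV) ?C"
    unfolding compactin_PiE by (auto intro: finite_imp_compact)
  then have "compact ?C" by (simp add: euclidean_product_topology)
  then have "seq_compact ?C" by (rule compact_imp_seq_compact)
  moreover have "\<forall>n. F n \<in> ?C" using assms by auto
  ultimately obtain x r where r: "strict_mono r" "(F \<circ> r) \<longlonglongrightarrow> x"
    unfolding seq_compact_def by blast
  have ev: "\<forall>\<^sub>F n in sequentially. F (r n) k = x k" for k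
  proof -
    have "continuous_on UNIV (\<lambda>y :: nat config. y k)" by simp
    from continuous_on_tendsto_compose[OF this r(2)]
    have "(\<lambda>n. (F \<circ> r) n k) \<longlonglongrightarrow> x k" by simp
    then show ?thesis by (simp add: tendsto_discrete)
  qed
  show ?thesis
  proof (rule that)
    fix S :: "(int \<times> int) set" and m assume "finite S"
    then have "\<forall>\<^sub>F n in sequentially. \<forall>k\<in>S. F (r n) k = x k"
      using ev by (simp add: eventually_ball_finite)
    then obtain M where "\<forall>n\<ge>M. \<forall>k\<in>S. F (r n) k = x k"
      unfolding eventually_sequentially by blast
    then have "\<forall>k\<in>S. F (r (max m M)) k = x k" by simp
    moreover have "m \<le> r (max m M)" using seq_suble[OF r(1), of "max m M"] by simp
    ultimately show "\<exists>n\<ge>m. \<forall>k\<in>S. F n k = x k" by blast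
  qed
qed

lemma square_mono: "M \<le> N \<Longrightarrow> square M \<subseteq> square N"
  by (auto simp: square_def)

text \<open>For every \<open>N\<close> the configuration agrees on the square of radius \<open>N\<close> with a generic coding, hence
  with a shifted image of some \<open>F N\<close>.  The four possible shifts reduce to one that serves all \<open>N\<close>,
  because agreement on a square gives agreement on the smaller ones.  A cluster point of \<open>F\<close> is then
  a preimage, by locality of the image.\<close>
lemma X_Z_desubstitution:
  assumes "y \<in> X_Z"
  obtains s x where "x \<in> X_Z" "y = shift s (config_image \<Phi> x)"
proof -
  let ?agree = "\<lambda>s N x. \<forall>k\<in>square (int N). shift s (config_image \<Phi> x) k = y k"
  define Q where "Q s N \<longleftrightarrow> (\<exists>x\<in>X_Z. ?agree s N x)" for s N
  have ex: "\<exists>s \<in> {0, 1} \<times> {0, 1}. Q s N" for N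
  proof -
    obtain u v where uv: "generic u v" "\<And>k. k \<in> square (int N) \<Longrightarrow> coding u v k = y k"
      using X_Z_agree[OF assms finite_square] by blast
    obtain s u' v' where s: "s \<in> {0, 1} \<times> {0, 1}" "generic u' v'"
      "coding u v = shift s (config_image \<Phi> (coding u' v'))"
      using coding_desubstitution[OF uv(1)] by blast
    then have "Q s N" unfolding Q_def using uv(2) coding_in_X_Z[OF s(2)] by metis
    with s(1) show ?thesis by blast
  qed
  have "\<exists>s. \<forall>N. Q s N"
  proof (rule ccontr)
    assume "\<nexists>s. \<forall>N. Q s N"
    then obtain n where n: "\<not> Q s (n s)" for s by metis
    define N where "N = (\<Sum>s \<in> {0, 1} \<times> {0, 1}. n s)"
    obtain s where s: "s \<in> {0, 1} \<times> {0, 1}" "Q s N" using ex by blast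
    have "n s \<le> N" unfolding N_def using s(1) by (intro member_le_sum) auto
    then have "Q s (n s)" using s(2) square_mono[of "int (n s)" "int N"] unfolding Q_def by fastforce
    with n show False by blast
  qed
  then obtain s where "\<forall>N. \<exists>x\<in>X_Z. ?agree s N x" unfolding Q_def by blast
  then obtain F where F: "\<And>N. F N \<in> X_Z" "\<And>N. ?agree s N (F N)" by metis
  obtain x where x: "\<And>S m. finite S \<Longrightarrow> \<exists>n\<ge>m. \<forall>k\<in>S. F n k = x k"
    using configs_cluster_point[of F 15] X_Z_le[OF F(1)] by metis
  have "x \<in> X_Z"
    by (rule X_Z_limit) (use x[OF finite_square] F(1) in metis)
  moreover have "y k = shift s (config_image \<Phi> x) k" for k
  proof -
    obtain N where N: "0 \<le> N" "{k, k + s} \<subseteq> square N"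
      using finite_subset_square[of "{k, k + s}"] by auto
    obtain n where n: "n \<ge> nat N" "\<forall>k\<in>square (N + 1). F n k = x k" using x[OF finite_square] by blast
    have "config_image \<Phi> (F n) (k + s) = config_image \<Phi> x (k + s)"
      by (rule config_image_local[of _ _ N]) (use n N X_Z_le[OF F(1)] Phi_size_pos in auto)
    moreover have "k \<in> square (int n)" using N(2) square_mono[of N "int n"] n(1) by (simp add: nat_le_iff) blast
    ultimately show ?thesis using F(2)[of n] by (simp add: shift_def)
  qed
  ultimately show ?thesis using that by blast
qed

lemma X_Z_eq_shift_closure: "X_Z = shift_closure (config_image \<Phi> ` X_Z)"
proof
  show "X_Z \<subseteq> shift_closure (config_image \<Phi> ` X_Z)"
  proof
    fix y assume "y \<in> X_Z"
    then obtain s x where "x \<in> X_Z" "y = shift s (config_image \<Phi> x)" by (rule X_Z_desubstitution)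
    then show "y \<in> shift_closure (config_image \<Phi> ` X_Z)" unfolding shift_closure_def by blast
  qed
  show "shift_closure (config_image \<Phi> ` X_Z) \<subseteq> X_Z"
    unfolding shift_closure_def using shift_X_Z config_image_X_Z by blast
qed

lemma subshift_X_Z: "subshift {0..15} X_Z"
  unfolding subshift_def
proof (intro conjI allI ballI shift_X_Z)
  let ?T = "product_topology (\<lambda>_ :: int \<times> int. discrete_topology {0..15 :: nat}) UNIV"
  have sub: "X_Z \<subseteq> topspace ?T" using X_Z_le by auto
  have "\<exists>U. openin ?T U \<and> x \<in> U \<and> U \<subseteq> topspace ?T - X_Z" if x: "x \<in> topspace ?T - X_Z" for x
  proof -
    obtain N where N: "\<And>x'. x' \<in> X_Z \<Longrightarrow> \<exists>k\<in>square N. x' k \<noteq> x k" using X_Z_limit x by blast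
    define U where "U = PiE UNIV (\<lambda>k. if k \<in> square N then {x k} else {0..15})"
    have "openin ?T U"
      unfolding U_def openin_PiE_gen using x finite_subset[OF _ finite_square[of N]]
      by (auto simp: PiE_iff split: if_splits intro!: finite_subset[OF _ finite_square[of N]])
    moreover have "x \<in> U" using x by (auto simp: U_def)
    moreover have "U \<subseteq> topspace ?T - X_Z"
    proof
      fix z assume "z \<in> U"
      then have z: "z k \<in> (if k \<in> square N then {x k} else {0..15})" for k
        unfolding U_def by blast
      moreover have "x k \<in> {0..15}" for k using x by auto
      ultimately have "z k \<in> {0..15}" for k by (metis singletonD)
      then have "z \<in> topspace ?T" by auto
      moreover have "z \<notin> X_Z" using N z by (metis singletonD)
      ultimately show "z \<in> topspace ?T - X_Z" by blast
    qed
    ultimately show ?thesis by blast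
  qed
  then have "openin ?T (topspace ?T - X_Z)" by (subst openin_subopen) blast
  with sub show "closedin ?T X_Z" by (simp add: closedin_def)
qed

section \<open>Expansivity\<close>

text \<open>Every atom is nonempty and open, so it contains a generic point.\<close>
lemma letter_occurs:
  assumes "a \<le> 15"
  obtains x where "x \<in> X_Z" "x (0, 0) = a"
proof -
  \<comment> \<open>approximate means of the vertices of the atoms\<close>
  define W :: "(real \<times> real) list" where "W =
    [(0.66, 0.66), (0.8, 0.8), (0.206, 0.745), (0.079, 0.745), (0.539, 0.794), (0.539, 0.921),
     (0.345, 0.809), (0.745, 0.127), (0.845, 0.405), (0.921, 0.539), (0.745, 0.333),
     (0.464, 0.405), (0.309, 0.309), (0.127, 0.127), (0.127, 0.333), (0.539, 0.539)]"
  define U where "U b = {p. in_strips b (fst p) (snd p) (fst p + snd p) (\<phi> * fst p + snd p)}" for b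
  have "\<forall>b\<le>15. W ! b \<in> U b"
    unfolding all_letters using golden_bounds
    by (simp add: W_def U_def in_strips_def strip_bounds_def)
  then have ne: "U a \<noteq> {}" using assms by blast
  have "\<forall>b\<le>15. open (U b)"
    unfolding all_letters U_def
    by (simp add: in_strips_def strip_bounds_def open_Collect_conj open_Collect_less continuous_intros)
  then have op: "open (U a)" using assms by blast
  obtain u v where uv: "(u, v) \<in> U a" "generic u v" using generic_exists[OF op ne] .
  have s: "in_strips a u v (u + v) (\<phi> * u + v)" using uv(1) by (simp add: U_def)
  have "frac u = u" "frac v = v" using in_strips_unit_square[OF assms s] by (simp_all add: frac_eq)
  then have "coding u v (0, 0) = a" using letter_of_in_strips[OF assms s] by (simp add: coding_def letter_def)
  with that coding_in_X_Z[OF uv(2)] show ?thesis by blast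
qed

definition subword :: "'a config \<Rightarrow> nat \<times> nat \<Rightarrow> 'a word2" where
  "subword x n = (n, restrict x (rect n))"

text \<open>The images of words that occur in a configuration are read off the image of the configuration.
  Iterates on a letter are therefore defined as soon as the letter occurs in \<open>X_Z\<close>.\<close>
lemma word_image_subword:
  assumes x: "matching \<omega> UNIV x" and width: "\<And>k. 1 \<le> width (\<omega> (x k))"
    and height: "\<And>k. 1 \<le> height (\<omega> (x k))" and n: "0 < fst n" "0 < snd n"
  shows "word_defined \<omega> (subword x n)"
    "word_image \<omega> (subword x n) = subword (config_image \<omega> x)
       (nat (pos (col_width \<omega> x) (fst n)), nat (pos (row_height \<omega> x) (snd n)))"
proof -
  let ?u = "letters (subword x n)"
  have u: "?u k = x k" if "k \<in> rect n" for k using that by (simp add: subword_def)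
  show "word_defined \<omega> (subword x n)"
    using x n by (simp add: word_defined_def subword_def matching_def)
  have c: "col_width \<omega> ?u i = col_width \<omega> x i" if "0 \<le> i" "i < int (fst n)" for i
    using that n by (simp add: col_width_def u rect_def)
  have r: "row_height \<omega> ?u i = row_height \<omega> x i" if "0 \<le> i" "i < int (snd n)" for i
    using that n by (simp add: row_height_def u rect_def)
  have C: "pos (col_width \<omega> ?u) i = pos (col_width \<omega> x) i" if "0 \<le> i" "i \<le> int (fst n)" for i
    using that c by (intro pos_cong) auto
  have R: "pos (row_height \<omega> ?u) i = pos (row_height \<omega> x) i" if "0 \<le> i" "i \<le> int (snd n)" for i
    using that r by (intro pos_cong) auto
  have "config_image \<omega> ?u (p, q) = config_image \<omega> x (p, q)"
    if pq: "0 \<le> p" "p < pos (col_width \<omega> x) (fst n)" "0 \<le> q" "q < pos (row_height \<omega> x) (snd n)" for p q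
  proof -
    obtain i where i: "0 \<le> i" "i < int (fst n)" "pos (col_width \<omega> x) i \<le> p" "p < pos (col_width \<omega> x) (i + 1)"
      using locate_exists[OF pq(1,2)] .
    obtain j where j: "0 \<le> j" "j < int (snd n)" "pos (row_height \<omega> x) j \<le> q" "q < pos (row_height \<omega> x) (j + 1)"
      using locate_exists[OF pq(3,4)] .
    have "config_image \<omega> x (p, q) = letters (\<omega> (x (i, j)))
        (p - pos (col_width \<omega> x) i, q - pos (row_height \<omega> x) j)"
      by (rule config_image_eq) (use i j in auto)
    moreover have "config_image \<omega> ?u (p, q) = letters (\<omega> (?u (i, j)))
        (p - pos (col_width \<omega> ?u) i, q - pos (row_height \<omega> ?u) j)"
      by (rule config_image_eq) (use i j C[of i] C[of "i + 1"] R[of j] R[of "j + 1"] in auto)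
    moreover have "?u (i, j) = x (i, j)" using i j by (simp add: u rect_def)
    ultimately show ?thesis using i j C[of i] R[of j] by simp
  qed
  then show "word_image \<omega> (subword x n) = subword (config_image \<omega> x)
       (nat (pos (col_width \<omega> x) (fst n)), nat (pos (row_height \<omega> x) (snd n)))"
    using C[of "int (fst n)"] R[of "int (snd n)"]
    by (auto simp: word_image_def Let_def subword_def rect_def restrict_def fun_eq_iff)
qed

lemma pos_growth:
  assumes "\<And>k. 1 \<le> d k" "0 < n"
  shows "n \<le> nat (pos d (int n))" "d 0 = 2 \<Longrightarrow> n < nat (pos d (int n))"
proof -
  show "n \<le> nat (pos d (int n))" using pos_le(1)[of d "int n"] assms(1) by force
  assume "d 0 = 2"
  define e where "e = (\<lambda>k. d (k + 1))"
  have "pos d (1 + int (n - 1)) = pos d 1 + pos e (int (n - 1))"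
    by (rule pos_add) (auto simp: e_def add.commute)
  moreover have "pos d 1 = 2" using pos_add_one[of d 0] \<open>d 0 = 2\<close> by (simp add: pos_def)
  moreover have "int (n - 1) \<le> pos e (int (n - 1))"
    using pos_le(1)[of e "int (n - 1)"] assms(1) by (simp add: e_def)
  ultimately show "n < nat (pos d (int n))" using assms(2) by (auto simp: of_nat_diff)
qed

text \<open>The lower left letter of an image has its atom in \<open>[0, 1/\<phi>)\<^sup>2\<close>, so its image is a block of two columns
  and two rows.\<close>
lemma Phi_Phi_size:
  assumes "a \<le> 15"
  shows "width (\<Phi> (letters (\<Phi> a) (0, 0))) = 2" "height (\<Phi> (letters (\<Phi> a) (0, 0))) = 2"
proof -
  have "\<forall>a\<le>15. width (\<Phi> (letters (\<Phi> a) (int 0, int 0))) = 2 \<and> height (\<Phi> (letters (\<Phi> a) (int 0, int 0))) = 2"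
    unfolding all_letters by (simp add: letters_Phi[of 0 _ 0, simplified] Phi_size Phi_matrices_def)
  then show "width (\<Phi> (letters (\<Phi> a) (0, 0))) = 2" "height (\<Phi> (letters (\<Phi> a) (0, 0))) = 2"
    using assms by simp_all
qed

lemma image_origin_size:
  assumes "x \<in> X_Z"
  shows "col_width \<Phi> (config_image \<Phi> x) 0 = 2" "row_height \<Phi> (config_image \<Phi> x) 0 = 2"
proof -
  have "0 < col_width \<Phi> x 0" "0 < row_height \<Phi> x 0"
    using Phi_size_pos[OF X_Z_le[OF assms, of "(0, 0)"]] by (simp_all add: col_width_def row_height_def)
  then have "config_image \<Phi> x (0, 0) = letters (\<Phi> (x (0, 0))) (0, 0)"
    using config_image_eq[of \<Phi> x 0 0 0 0] pos_add_one[of "col_width \<Phi> x" 0]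
      pos_add_one[of "row_height \<Phi> x" 0] by (simp add: pos_def)
  then show "col_width \<Phi> (config_image \<Phi> x) 0 = 2" "row_height \<Phi> (config_image \<Phi> x) 0 = 2"
    using Phi_Phi_size[OF X_Z_le[OF assms]] by (simp_all add: col_width_def row_height_def)
qed

text \<open>From the second iteration on the first column and the first row of the word are doubled, so that both
  dimensions increase at each step.\<close>
lemma expansive_Phi: "expansive {0..15} \<Phi>"
  unfolding expansive_def
proof (intro ballI allI)
  fix a :: nat and K assume "a \<in> {0..15}"
  then have "a \<le> 15" by simp
  then obtain x where x: "x \<in> X_Z" "x (0, 0) = a" by (rule letter_occurs)
  define y where "y m = (config_image \<Phi> ^^ m) x" for m
  have y: "y m \<in> X_Z" for m by (induction m) (simp_all add: y_def x config_image_X_Z)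
  have ge: "1 \<le> width (\<Phi> (y m k))" "1 \<le> height (\<Phi> (y m k))" for m k
    using Phi_size_pos X_Z_le[OF y] by blast+
  define w where "w m = (word_image \<Phi> ^^ m) (letter_word a)" for m
  have w: "\<exists>n. w m = subword (y m) n \<and> 0 < fst n \<and> 0 < snd n \<and> m \<le> fst n \<and> m \<le> snd n" for m
  proof (induction m)
    case 0
    have "rect (1, 1) = {(0, 0)}" by (auto simp: rect_def)
    then have "w 0 = subword (y 0) (1, 1)"
      using x(2) by (auto simp: w_def y_def letter_word_def subword_def restrict_def fun_eq_iff)
    then show ?case by (intro exI[of _ "(1, 1)"]) simp
  next
    case (Suc m)
    then obtain n where n: "w m = subword (y m) n" "0 < fst n" "0 < snd n" "m \<le> fst n" "m \<le> snd n"
      by blast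
    define n' where "n' = (nat (pos (col_width \<Phi> (y m)) (fst n)), nat (pos (row_height \<Phi> (y m)) (snd n)))"
    have w': "w (Suc m) = subword (y (Suc m)) n'"
      using word_image_subword(2)[OF matching_X_Z[OF y] ge n(2,3)] n(1) by (simp add: w_def y_def n'_def)
    have d: "1 \<le> col_width \<Phi> (y m) k" "1 \<le> row_height \<Phi> (y m) k" for k
      using ge by (auto simp only: col_width_def row_height_def)
    have le: "fst n \<le> fst n'" "snd n \<le> snd n'"
      using pos_growth(1)[OF d(1) n(2)] pos_growth(1)[OF d(2) n(3)] by (simp_all add: n'_def)
    have less: "fst n < fst n' \<and> snd n < snd n'" if nonzero: "m \<noteq> 0"
    proof -
      obtain l where "m = Suc l" using not0_implies_Suc[OF nonzero] by blast
      then have "col_width \<Phi> (y m) 0 = 2" "row_height \<Phi> (y m) 0 = 2"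
        using image_origin_size[OF y, of l] by (simp_all add: y_def)
      then show ?thesis
        using pos_growth(2)[OF d(1) n(2)] pos_growth(2)[OF d(2) n(3)] by (simp add: n'_def)
    qed
    have "0 < fst n'" "0 < snd n'" "Suc m \<le> fst n'" "Suc m \<le> snd n'"
      using n(2-5) le less by (cases "m = 0"; linarith)+
    with w' show ?case by (intro exI[of _ n'] conjI) simp_all
  qed
  have "iterate_defined \<Phi> m a" for m
    unfolding iterate_defined_def
  proof (intro allI impI)
    fix k
    obtain n where "w k = subword (y k) n" "0 < fst n" "0 < snd n" using w by blast
    then show "word_defined \<Phi> ((word_image \<Phi> ^^ k) (letter_word a))"
      using word_image_subword(1)[OF matching_X_Z[OF y] ge] by (simp add: w_def)
  qed
  moreover have "K < width (w (Suc K)) \<and> K < height (w (Suc K))"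
  proof -
    obtain n where "w (Suc K) = subword (y (Suc K)) n" "Suc K \<le> fst n" "Suc K \<le> snd n"
      using w by blast
    then show ?thesis by (simp add: subword_def)
  qed
  ultimately show "\<exists>m. iterate_defined \<Phi> m a \<and> K < width ((word_image \<Phi> ^^ m) (letter_word a)) \<and>
      K < height ((word_image \<Phi> ^^ m) (letter_word a))"
    unfolding w_def by (intro exI[of _ "Suc K"] conjI) auto
qed

lemma Phi_words: "\<Phi> \<in> {0..15} \<rightarrow> words2 {0..15}"
proof
  fix a :: nat assume "a \<in> {0..15}"
  have "\<forall>a\<le>15. \<forall>k < width (\<Phi> a). \<forall>l < height (\<Phi> a). rev (Phi_matrices ! a) ! l ! k \<le> 15"
    unfolding all_letters by (simp add: Phi_size Phi_matrices_def All_less_Suc)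
  with \<open>a \<in> {0..15}\<close> have "letters (\<Phi> a) (int k, int l) \<le> 15"
    if "k < width (\<Phi> a)" "l < height (\<Phi> a)" for k l
    using that by (simp add: letters_Phi)
  then have "letters (\<Phi> a) (i, j) \<le> 15" if "(i, j) \<in> rect (fst (\<Phi> a))" for i j
    using that by (auto simp: rect_def dest!: zero_le_imp_eq_int)
  moreover have "letters (\<Phi> a) \<in> extensional (rect (fst (\<Phi> a)))"
    by (simp add: Phi_def word_of_matrix_def Let_def)
  ultimately have "letters (\<Phi> a) \<in> rect (fst (\<Phi> a)) \<rightarrow>\<^sub>E {0..15}"
    by (auto simp: PiE_def)
  then show "\<Phi> a \<in> words2 {0..15}" by (simp add: words2_def case_prod_unfold)
qed

theorem theorem1p2:
  shows "self_similar {0..15} X_Z \<and>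
    \<Phi> \<in> {0..15} \<rightarrow> words2 {0..15} \<and> expansive {0..15} \<Phi> \<and>
    (\<forall>x\<in>X_Z. matching \<Phi> UNIV x) \<and>
    X_Z = shift_closure (config_image \<Phi> ` X_Z)"
  unfolding self_similar_def
  using subshift_X_Z Phi_words expansive_Phi matching_X_Z X_Z_eq_shift_closure by blast

end
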